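(* Let $n,m\in\mathbb{N}$, let $A\in\mathbb{R}^{n\times n}$ be Hurwitz, and let $B\in\mathbb{R}^{n\times m}$, $C\in\mathbb{R}^{m\times n}$, $D\in\mathbb{R}^{m\times m}$. Let $\Sigma$ be the linear time-invariant system $\dot x(t)=Ax(t)+Bu(t)$, $y(t)=Cx(t)+Du(t)$. Let $\mathcal{L}\colon\mathbb{R}^{n\times n}\to\mathbb{R}^{n\times n}$, $\mathcal{L}(X)=A^{\mathsf T}X+XA$, which is invertible since $A$ is Hurwitz. Then $\Sigma$ is passive if and only if there exist matrices $L\in\mathbb{R}^{n\times m}$ and $M\in\mathbb{R}^{m\times m}$ such that $$C=B^{\mathsf T}\mathcal{L}^{-1}\big(-LL^{\mathsf T}\big)+ML^{\mathsf T}\qquad\text{and}\qquad D+D^{\mathsf T}=MM^{\mathsf T}.$$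
   Context: A real square matrix is Hurwitz if all its eigenvalues have negative real part; the system is called asymptotically stable if $A$ is Hurwitz. The system $\Sigma$ is called passive if there exists a function $\mathcal{H}\colon\mathbb{R}^n\to[0,\infty)$ (a storage function) such that $$\mathcal{H}(x(t_2))\le\mathcal{H}(x(t_1))+\int_{t_1}^{t_2}u(t)^{\mathsf T}y(t)\,\mathrm{d}t$$ for all solution trajectories $(u,x,y)$ of the system and all $t_1\le t_2$. (Inputs $u$ may be taken locally square integrable, with $x$ the corresponding absolutely continuous solution.) *)

theory Defs
  imports "HOL-Analysis.Analysis"
begin

definition eigenvalue_mat :: "complex^'n^'n \<Rightarrow> complex \<Rightarrow> bool" where
  "eigenvalue_mat A z \<longleftrightarrow> (\<exists>v. v \<noteq> 0 \<and> A *v v = z *s v)"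

(* The eigenvalues of a real matrix are its complex ones. *)
definition hurwitz :: "real^'n^'n \<Rightarrow> bool" where
  "hurwitz A \<longleftrightarrow> (\<forall>z. eigenvalue_mat (map_matrix complex_of_real A) z \<longrightarrow> Re z < 0)"

definition lyapunov_op :: "real^'n^'n \<Rightarrow> real^'n^'n \<Rightarrow> real^'n^'n" where
  "lyapunov_op A X = transpose A ** X + X ** A"

(* A division is a finite set of closed intervals with pairwise disjoint interiors;
   Inf K and Sup K are the endpoints of such an interval K. *)
definition absolutely_continuous_on_interval ::
    "real \<Rightarrow> real \<Rightarrow> (real \<Rightarrow> 'a::real_normed_vector) \<Rightarrow> bool" where
  "absolutely_continuous_on_interval a b f \<longleftrightarrow>
    (\<forall>\<epsilon>>0. \<exists>\<delta>>0. \<forall>\<D> T. \<D> division_of T \<and> T \<subseteq> {a..b} \<and> (\<Sum>K\<in>\<D>. Sup K - Inf K) < \<delta> \<longrightarrow>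
      (\<Sum>K\<in>\<D>. norm (f (Sup K) - f (Inf K))) < \<epsilon>)"

definition locally_absolutely_continuous :: "(real \<Rightarrow> 'a::real_normed_vector) \<Rightarrow> bool" where
  "locally_absolutely_continuous f \<longleftrightarrow> (\<forall>a b. absolutely_continuous_on_interval a b f)"

definition locally_square_integrable :: "(real \<Rightarrow> 'a::euclidean_space) \<Rightarrow> bool" where
  "locally_square_integrable u \<longleftrightarrow> u \<in> borel_measurable lebesgue \<and>
    (\<forall>a b. set_integrable lebesgue {a..b} (\<lambda>t. (norm (u t))\<^sup>2))"

(* Trajectories live on the whole time axis and the initial state is arbitrary. Every locally
   square integrable input on a subinterval extends by zero, so this loses no behaviour. *)
definition trajectory ::
    "real^'n^'n \<Rightarrow> real^'m^'n \<Rightarrow> real^'n^'m \<Rightarrow> real^'m^'m \<Rightarrow>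
     (real \<Rightarrow> real^'m) \<Rightarrow> (real \<Rightarrow> real^'n) \<Rightarrow> (real \<Rightarrow> real^'m) \<Rightarrow> bool" where
  "trajectory A B C D u x y \<longleftrightarrow>
    locally_square_integrable u \<and>
    locally_absolutely_continuous x \<and>
    (AE t in lebesgue. (x has_vector_derivative (A *v x t + B *v u t)) (at t)) \<and>
    (\<forall>t. y t = C *v x t + D *v u t)"

(* The supply rate is integrable along every trajectory, since u is locally square integrable
   and x is continuous; the Lebesgue integral therefore never takes its default value 0. *)
definition storage_function ::
    "real^'n^'n \<Rightarrow> real^'m^'n \<Rightarrow> real^'n^'m \<Rightarrow> real^'m^'m \<Rightarrow> (real^'n \<Rightarrow> real) \<Rightarrow> bool" where
  "storage_function A B C D \<H> \<longleftrightarrow>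
    (\<forall>\<xi>. 0 \<le> \<H> \<xi>) \<and>
    (\<forall>u x y t\<^sub>1 t\<^sub>2. trajectory A B C D u x y \<and> t\<^sub>1 \<le> t\<^sub>2 \<longrightarrow>
      \<H> (x t\<^sub>2) \<le> \<H> (x t\<^sub>1) + (LINT t:{t\<^sub>1..t\<^sub>2}|lebesgue. u t \<bullet> y t))"

definition is_passive ::
    "real^'n^'n \<Rightarrow> real^'m^'n \<Rightarrow> real^'n^'m \<Rightarrow> real^'m^'m \<Rightarrow> bool" where
  "is_passive A B C D \<longleftrightarrow> (\<exists>\<H>. storage_function A B C D \<H>)"

end

(* If X solves the Lyapunov equation with right-hand side -L L^T, then x^T X x / 2 is nonnegative
   because A is Hurwitz, and the supply u^T y exceeds its derivative by |M^T u + L^T x|^2 / 2, so it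
   is a storage function.

   Conversely, the available storage (the supremum of the energy that can be extracted from a given
   state) is finite, satisfies the parallelogram law and scales quadratically, hence equals
   x^T X x / 2 for a symmetric X, and the dissipation rate w(x, u) = 2 u^T y - d/dt (x^T X x) is a
   nonnegative quadratic form. If D + D^T = M M^T is invertible, completing the square gives
   w = |M^T u + L^T x|^2 + x^T Q x with Q >= 0. Along an almost optimal extraction the integral of w
   is arbitrarily small, so the extraction is nearly the closed loop M^T u = -L^T x near its initial
   state; this forces Q = 0, which is the Lyapunov equation. In the singular case replace D by
   D + e I, bound X, L and M uniformly, and let e tend to 0. *)

theory Submission
  imports Defs "HOL-Computational_Algebra.Fundamental_Theorem_Algebra"
begin

section \<open>Flows of linear vector fields\<close>

text \<open>Nonnegativity of the form w on R^(n+m) alone would allow a factor with up to n+m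
  columns, whereas \<open>L\<close> and \<open>M\<close> have only m. So an arbitrary quadratic
  storage function is not enough: the extremal one is needed, because its residual Q vanishes. A
  given storage function may be neither continuous nor quadratic; it enters only as a finite upper
  bound for the extractable energy, and one such bound serves all regularized systems, since adding
  e I with e >= 0 only increases the supply. The two directions use different classes of solutions.
  Sufficiency must treat every absolutely continuous trajectory and therefore needs a fundamental
  theorem of calculus for such functions. For necessity it is enough to extract energy along states
  that are differentiable off a finite set, with locally bounded Borel inputs; existence is then
  needed for constant inputs only. Decay of the flow is obtained without a normal form: each vector
  is killed by a product of factors A - l I with eigenvalues l, and every factor gives a stable
  scalar equation with a decaying forcing term.\<close>

definition flow :: "('a::euclidean_space \<Rightarrow> 'a) \<Rightarrow> real \<Rightarrow> 'a \<Rightarrow> 'a" where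
  "flow f t v = (\<Sum>k. (t ^ k / fact k) *\<^sub>R (f ^^ k) v)"

lemma norm_funpow_le:
  fixes f :: "'a::real_normed_vector \<Rightarrow> 'a"
  assumes "\<And>v. norm (f v) \<le> norm v * K" "0 \<le> K"
  shows "norm ((f ^^ k) v) \<le> K ^ k * norm v"
proof (induction k)
  case (Suc k)
  have "norm ((f ^^ Suc k) v) \<le> norm ((f ^^ k) v) * K"
    using assms(1) by simp
  also have "\<dots> \<le> (K ^ k * norm v) * K"
    using Suc assms(2) by (rule mult_right_mono)
  finally show ?case by (simp add: mult_ac)
qed simp

lemma linear_funpow:
  fixes f :: "'a::real_vector \<Rightarrow> 'a"
  assumes "linear f"
  shows "linear (f ^^ k)"
proof (induction k)
  case 0
  show ?case by (simp add: linear_id[unfolded id_def] id_def)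
next
  case (Suc k)
  then show ?case using linear_compose[OF Suc assms] by (simp add: o_def)
qed

text \<open>\<open>flow f t v\<close> is exp(t f) v, written as a series of vectors so that one
  construction serves real, complex and product spaces. If K bounds f, the scalar series of exp(|t|
  K) dominates it.\<close>

lemma summable_flow:
  fixes f :: "'a::euclidean_space \<Rightarrow> 'a"
  assumes "linear f"
  shows "summable (\<lambda>k. (t ^ k / fact k) *\<^sub>R (f ^^ k) v)"
proof -
  have bl: "bounded_linear f" using assms by (simp add: linear_conv_bounded_linear)
  obtain K where K: "0 \<le> K" "\<And>v. norm (f v) \<le> norm v * K"
    using bounded_linear.nonneg_bounded[OF bl] by auto
  have "summable (\<lambda>k. (\<bar>t\<bar> * K) ^ k / fact k * norm v)"
    using summable_exp_generic[of "\<bar>t\<bar> * K"]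
    by (intro summable_mult2) (simp add: divide_inverse mult.commute)
  then show ?thesis
  proof (rule summable_comparison_test'[where N = 0])
    fix k :: nat
    have "norm ((t ^ k / fact k) *\<^sub>R (f ^^ k) v) \<le> (\<bar>t\<bar> ^ k / fact k) * (K ^ k * norm v)"
      using norm_funpow_le[OF K(2,1), of k v]
      by (auto simp: power_abs intro!: mult_left_mono divide_right_mono)
    then show "norm ((t ^ k / fact k) *\<^sub>R (f ^^ k) v) \<le> (\<bar>t\<bar> * K) ^ k / fact k * norm v"
      by (simp add: power_mult_distrib mult_ac)
  qed
qed

lemma flow_0 [simp]: "flow f 0 v = v"
proof -
  have "flow f 0 v = (\<Sum>k. if k = 0 then v else 0)"
    unfolding flow_def by (intro arg_cong[where f = suminf] ext) auto
  then show ?thesis using suminf_finite[of "{0}" "\<lambda>k::nat. if k = 0 then v else 0"] by simp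
qed

lemma flow_zero_vector:
  assumes "linear f"
  shows "flow f t 0 = 0"
  using linear_funpow[OF assms] by (simp add: flow_def linear_0)

text \<open>An intertwining map passes through every power of f and, by continuity, through the
  series. It is needed for the generator itself, for the factors A - l I, and for
  complexification.\<close>

lemma flow_bounded_linear_commute:
  fixes f :: "'a::euclidean_space \<Rightarrow> 'a" and g :: "'b::euclidean_space \<Rightarrow> 'b"
    and h :: "'a \<Rightarrow> 'b"
  assumes "linear f" "linear h" "\<And>v. h (f v) = g (h v)"
  shows "h (flow f t v) = flow g t (h v)"
proof -
  have hk: "h ((f ^^ k) v) = (g ^^ k) (h v)" for k
    by (induction k) (simp_all add: assms(3))
  have "bounded_linear h" using assms(2) by (simp add: linear_conv_bounded_linear)
  then have "h (flow f t v) = (\<Sum>k. h ((t ^ k / fact k) *\<^sub>R (f ^^ k) v))"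
    unfolding flow_def by (rule bounded_linear.suminf[OF _ summable_flow[OF assms(1)]])
  also have "\<dots> = flow g t (h v)"
    unfolding flow_def by (simp add: linear_scale[OF assms(2)] hk)
  finally show ?thesis .
qed

text \<open>Each component of the flow is a real power series in t, so termwise differentiation
  applies; shifting the coefficients by one index replaces v by f v.\<close>

lemma flow_has_vector_derivative:
  fixes f :: "'a::euclidean_space \<Rightarrow> 'a"
  assumes f: "linear f"
  shows "((\<lambda>t. flow f t v) has_vector_derivative f (flow f t v)) (at t)"
proof -
  have comp: "flow f s w \<bullet> b = (\<Sum>k. ((f ^^ k) w \<bullet> b / fact k) * s ^ k)" for s w b
    unfolding flow_def
    by (subst bounded_linear.suminf[OF bounded_linear_inner_left summable_flow[OF f]])
      (simp add: mult_ac)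
  have sm: "summable (\<lambda>k. ((f ^^ k) w \<bullet> b / fact k) * s ^ k)" for s w b
    using bounded_linear.summable[OF bounded_linear_inner_left summable_flow[OF f], of s w b]
    by (simp add: mult_ac)
  have ff: "f (flow f t v) = flow f t (f v)"
    by (rule flow_bounded_linear_commute[OF f f]) simp
  have "((\<lambda>t. flow f t v \<bullet> b) has_field_derivative (flow f t (f v) \<bullet> b)) (at t)" for b
  proof -
    have "diffs (\<lambda>k. (f ^^ k) v \<bullet> b / fact k) = (\<lambda>k. (f ^^ k) (f v) \<bullet> b / fact k)"
      by (rule ext) (simp add: diffs_def funpow_swap1 del: of_nat_Suc)
    then show ?thesis
      unfolding comp using termdiffs_strong_converges_everywhere[OF sm[of v b], of t] by simp
  qed
  then show ?thesis
    unfolding ff has_vector_derivative_def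
    by (subst has_derivative_componentwise_within)
      (simp add: has_field_derivative_def mult_commute_abs)
qed

section \<open>Asymptotic stability of Hurwitz matrices\<close>

text \<open>A Gronwall argument: once r < a e / 2, the function (g - e / 2) exp(a t) no longer
  increases, so the excess of g over e / 2 is at most a multiple of exp(-a t).\<close>

lemma differential_inequality_tendsto_0:
  fixes g g' r :: "real \<Rightarrow> real"
  assumes a: "0 < a"
    and deriv: "\<And>t. (g has_real_derivative g' t) (at t)"
    and le: "\<And>t. g' t \<le> r t - a * g t"
    and nonneg: "\<And>t. 0 \<le> g t"
    and r: "(r \<longlongrightarrow> 0) at_top"
  shows "(g \<longlongrightarrow> 0) at_top"
proof (rule tendstoI)
  fix e :: real assume e: "0 < e"
  have "\<forall>\<^sub>F t in at_top. r t < a * (e / 2)"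
    using order_tendstoD(2)[OF r, of "a * (e / 2)"] a e by simp
  then obtain T where T: "\<And>t. t \<ge> T \<Longrightarrow> r t < a * (e / 2)"
    unfolding eventually_at_top_linorder by blast
  define h where "h t = (g t - e / 2) * exp (a * t)" for t
  have h: "h t \<le> h T" if "T \<le> t" for t
  proof (rule DERIV_nonpos_imp_nonincreasing[OF that])
    fix s assume s: "T \<le> s" "s \<le> t"
    have "(h has_real_derivative g' s * exp (a * s) + (g s - e / 2) * (exp (a * s) * a)) (at s)"
      unfolding h_def by (auto intro!: derivative_eq_intros deriv)
    moreover have "g' s * exp (a * s) + (g s - e / 2) * (exp (a * s) * a)
        = (g' s + a * g s - a * (e / 2)) * exp (a * s)"
      by (simp add: algebra_simps)
    moreover have "g' s + a * g s - a * (e / 2) \<le> 0"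
      using le[of s] T[OF s(1)] by linarith
    ultimately show "\<exists>y. (h has_real_derivative y) (at s) \<and> y \<le> 0"
      by (metis exp_ge_zero mult_nonpos_nonneg)
  qed
  have "filterlim (\<lambda>t. - (a * t)) at_bot at_top"
    unfolding filterlim_uminus_at_bot minus_minus
    by (rule filterlim_tendsto_pos_mult_at_top[OF tendsto_const a filterlim_ident])
  then have "((\<lambda>t. h T * exp (- (a * t))) \<longlongrightarrow> h T * 0) at_top"
    by (intro tendsto_mult tendsto_const) (rule filterlim_compose[OF exp_at_bot])
  then have "\<forall>\<^sub>F t in at_top. h T * exp (- (a * t)) < e / 2"
    by (rule order_tendstoD) (use e in simp)
  then show "\<forall>\<^sub>F t in at_top. dist (g t) 0 < e"
    using eventually_ge_at_top[of T]
  proof eventually_elim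
    case (elim t)
    have "g t - e / 2 = h t * exp (- (a * t))"
      unfolding h_def by (simp add: exp_minus mult.assoc)
    also have "\<dots> \<le> h T * exp (- (a * t))"
      using h[OF elim(2)] by (intro mult_right_mono) auto
    finally show ?case using elim nonneg[of t] by simp
  qed
qed

text \<open>The real inner product is the real part of the Hermitian one, for which multiplication
  by i is skew; only Re c survives.\<close>

lemma inner_scaleC_self:
  fixes z :: "complex^'n"
  shows "z \<bullet> (c *s z) = Re c * (norm z)\<^sup>2"
proof -
  have "w \<bullet> (c * w) = Re c * (w \<bullet> w)" for w :: complex
    by (simp add: inner_complex_def algebra_simps)
  then show ?thesis
    by (simp add: power2_norm_eq_inner inner_vec_def sum_distrib_left)
qed

text \<open>Energy estimate with a = - Re c: the squared norm decays at rate 2 a, and Young's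
  inequality spends half of this on the forcing term, leaving rate a and the remainder |y|^2 /
  a.\<close>

lemma stable_scalar_equation_tendsto_0:
  fixes z y :: "real \<Rightarrow> complex^'n"
  assumes c: "Re c < 0"
    and z: "\<And>t. (z has_vector_derivative (c *s z t + y t)) (at t)"
    and y: "(y \<longlongrightarrow> 0) at_top"
  shows "(z \<longlongrightarrow> 0) at_top"
proof -
  define a where "a = - Re c"
  have a: "0 < a" using c by (simp add: a_def)
  have "((\<lambda>t. z t \<bullet> z t) \<longlongrightarrow> 0) at_top"
  proof (rule differential_inequality_tendsto_0[OF a])
    show "((\<lambda>t. z t \<bullet> z t) has_real_derivative 2 * (z t \<bullet> (c *s z t + y t))) (at t)" for t
      using has_derivative_inner[OF z[of t, unfolded has_vector_derivative_def]
          z[of t, unfolded has_vector_derivative_def]]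
      unfolding has_field_derivative_def
      by (rule has_derivative_eq_rhs) (auto simp: inner_commute algebra_simps)
    show "((\<lambda>t. (norm (y t))\<^sup>2 / a) \<longlongrightarrow> 0) at_top"
      using y a by (auto intro!: tendsto_eq_intros)
    show "0 \<le> z t \<bullet> z t" for t by simp
    fix t
    have "2 * (z t \<bullet> y t) \<le> a * (norm (z t))\<^sup>2 + (norm (y t))\<^sup>2 / a"
    proof -
      have "0 \<le> (a * norm (z t) - norm (y t))\<^sup>2 / a" using a by simp
      also have "\<dots> = a * (norm (z t))\<^sup>2 + (norm (y t))\<^sup>2 / a - 2 * (norm (z t) * norm (y t))"
        using a by (simp add: power2_eq_square field_simps)
      finally show ?thesis using norm_cauchy_schwarz[of "z t" "y t"] by linarith
    qed
    moreover have "2 * (z t \<bullet> (c *s z t + y t)) = - 2 * a * (norm (z t))\<^sup>2 + 2 * (z t \<bullet> y t)"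
      by (simp add: inner_add_right inner_scaleC_self a_def)
    ultimately show "2 * (z t \<bullet> (c *s z t + y t)) \<le> (norm (y t))\<^sup>2 / a - a * (z t \<bullet> z t)"
      by (simp add: power2_norm_eq_inner)
  qed
  then have "((\<lambda>t. norm (z t)) \<longlongrightarrow> sqrt 0) at_top"
    unfolding norm_eq_sqrt_inner by (intro tendsto_real_sqrt)
  then show ?thesis by (simp add: tendsto_norm_zero_iff)
qed

section \<open>Eigenvalue factors that annihilate a given vector\<close>

lemma exists_linear_relation:
  fixes f :: "nat \<Rightarrow> 'a::euclidean_space"
  shows "\<exists>c. (\<exists>i\<le>DIM('a). c i \<noteq> 0) \<and> (\<Sum>i\<le>DIM('a). c i *\<^sub>R f i) = 0"
proof (cases "inj_on f {..DIM('a)}")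
  case True
  have "DIM('a) < card (f ` {..DIM('a)})" using card_image[OF True] by simp
  then have "dependent (f ` {..DIM('a)})" by (intro dependent_biggerset) simp
  then obtain u w where u: "w \<in> f ` {..DIM('a)}" "u w \<noteq> 0"
      "(\<Sum>v\<in>f ` {..DIM('a)}. u v *\<^sub>R v) = 0"
    by (subst (asm) dependent_finite) auto
  then have "(\<Sum>i\<le>DIM('a). u (f i) *\<^sub>R f i) = 0"
    by (simp add: sum.reindex[OF True])
  then show ?thesis using u by (intro exI[of _ "\<lambda>i. u (f i)"]) auto
next
  \<comment> \<open>Linear dependence of the image set does not see a repeated vector, so a
    repetition supplies its own relation f i - f j = 0.\<close>
  case False
  then obtain i j where ij: "i \<le> DIM('a)" "j \<le> DIM('a)" "i \<noteq> j" "f i = f j"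
    by (auto simp: inj_on_def)
  define c where "c k = (if k = i then 1 else if k = j then -1 else 0 :: real)" for k
  have "(\<Sum>k\<le>DIM('a). c k *\<^sub>R f k) = (\<Sum>k\<in>{i,j}. c k *\<^sub>R f k)"
    using ij by (intro sum.mono_neutral_right) (auto simp: c_def)
  also have "\<dots> = 0" using ij by (simp add: c_def)
  finally show ?thesis using ij by (intro exI[of _ c]) (auto simp: c_def)
qed

text \<open>This is p(A) v. Fixing the vector makes a linear relation among its iterates enough,
  with no appeal to the characteristic polynomial.\<close>

definition poly_matrix_vector :: "complex^'n^'n \<Rightarrow> complex poly \<Rightarrow> complex^'n \<Rightarrow> complex^'n" where
  "poly_matrix_vector A p v = (\<Sum>i\<le>degree p. coeff p i *s (((*v) A) ^^ i) v)"

lemma poly_matrix_vector_bound: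
  assumes "degree p \<le> N"
  shows "poly_matrix_vector A p v = (\<Sum>i\<le>N. coeff p i *s (((*v) A) ^^ i) v)"
  unfolding poly_matrix_vector_def
  using assms by (intro sum.mono_neutral_left) (auto simp: coeff_eq_0)

text \<open>The coefficients of (X - l) q are those of q shifted by one, minus l times those of q;
  the shift becomes one more application of A.\<close>

lemma poly_matrix_vector_linear_factor:
  "poly_matrix_vector A ([:- l, 1:] * q) v = poly_matrix_vector A q (A *v v - l *s v)"
proof -
  let ?f = "(*v) A"
  have lin: "linear (?f ^^ i)" for i by (intro linear_funpow) simp
  have scale: "(?f ^^ i) (c *s w) = c *s (?f ^^ i) w" for i c w
    by (induction i) (simp_all add: vector_scalar_commute)
  have deg: "degree ([:- l, 1:] * q) \<le> Suc (degree q)"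
    by (rule order_trans[OF degree_mult_le]) simp
  have "poly_matrix_vector A ([:- l, 1:] * q) v
      = (\<Sum>i\<le>Suc (degree q). (coeff (pCons 0 q) i - l * coeff q i) *s (?f ^^ i) v)"
    unfolding poly_matrix_vector_bound[OF deg] by (intro sum.cong) simp_all
  also have "\<dots> = (\<Sum>i\<le>Suc (degree q). coeff (pCons 0 q) i *s (?f ^^ i) v)
      - (\<Sum>i\<le>Suc (degree q). l * coeff q i *s (?f ^^ i) v)"
    by (simp only: vec.scale_left_diff_distrib sum_subtractf)
  also have "(\<Sum>i\<le>Suc (degree q). coeff (pCons 0 q) i *s (?f ^^ i) v)
      = (\<Sum>i\<le>degree q. coeff q i *s (?f ^^ i) (A *v v))"
    by (subst sum.atMost_Suc_shift) (simp add: funpow_swap1)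
  also have "(\<Sum>i\<le>Suc (degree q). l * coeff q i *s (?f ^^ i) v)
      = (\<Sum>i\<le>degree q. coeff q i *s (?f ^^ i) (l *s v))"
    by (simp add: coeff_eq_0 scale vec.scale_scale mult.commute)
  finally show ?thesis
    unfolding poly_matrix_vector_def
    by (simp add: sum_subtractf[symmetric] linear_diff[OF lin] vec.scale_right_diff_distrib)
qed

lemma matrix_poly_matrix_vector_commute:
  "A *v poly_matrix_vector A q v - l *s poly_matrix_vector A q v
    = poly_matrix_vector A q (A *v v - l *s v)"
proof -
  let ?f = "(*v) A"
  have lin: "linear (?f ^^ i)" for i by (intro linear_funpow) simp
  have scale: "(?f ^^ i) (c *s w) = c *s (?f ^^ i) w" for i c w
    by (induction i) (simp_all add: vector_scalar_commute)
  have "A *v poly_matrix_vector A q v = (\<Sum>i\<le>degree q. coeff q i *s (?f ^^ i) (A *v v))"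
    unfolding poly_matrix_vector_def
    by (subst linear_sum[OF matrix_vector_mul_linear])
      (simp add: vector_scalar_commute funpow_swap1)
  moreover have "l *s poly_matrix_vector A q v
      = (\<Sum>i\<le>degree q. coeff q i *s (?f ^^ i) (l *s v))"
    unfolding poly_matrix_vector_def
    by (simp add: vec.scale_sum_right scale vec.scale_scale mult.commute)
  ultimately show ?thesis
    unfolding poly_matrix_vector_def
    by (simp add: sum_subtractf[symmetric] linear_diff[OF lin] vec.scale_right_diff_distrib)
qed

text \<open>Dimension is counted over the reals, so 2n + 1 iterates satisfy a relation with real
  coefficients.\<close>

lemma exists_annihilating_poly:
  fixes A :: "complex^'n^'n"
  shows "\<exists>p. p \<noteq> 0 \<and> poly_matrix_vector A p v = 0"
proof -
  let ?N = "DIM(complex^'n)"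
  obtain c where c: "\<exists>i\<le>?N. c i \<noteq> 0" "(\<Sum>i\<le>?N. c i *\<^sub>R (((*v) A) ^^ i) v) = 0"
    using exists_linear_relation[of "\<lambda>i. (((*v) A) ^^ i) v"] by blast
  define p where "p = (\<Sum>i\<le>?N. monom (complex_of_real (c i)) i)"
  have coeff: "coeff p i = (if i \<le> ?N then complex_of_real (c i) else 0)" for i
    unfolding p_def by (simp add: coeff_sum coeff_monom)
  have deg: "degree p \<le> ?N"
    by (rule degree_le) (simp add: coeff)
  have "complex_of_real r *s w = r *\<^sub>R w" for r and w :: "complex^'n"
    by (simp add: vec_eq_iff scaleR_conv_of_real[where 'a = complex])
  then have "poly_matrix_vector A p v = 0"
    unfolding poly_matrix_vector_bound[OF deg] using c(2) by (simp add: coeff cong: sum.cong_simp)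
  moreover have "p \<noteq> 0"
  proof -
    obtain i where "i \<le> ?N" "c i \<noteq> 0" using c(1) by blast
    then have "coeff p i \<noteq> 0" unfolding coeff by simp
    then show ?thesis by auto
  qed
  ultimately show ?thesis by blast
qed

text \<open>Take an annihilating p of minimal degree and a root l, p = (X - l) q. By minimality q(A)
  v is nonzero, and A - l I kills it, so l is an eigenvalue. The vector (A - l I) v is annihilated
  by q, which has smaller degree.\<close>

lemma exists_annihilating_eigenvalues:
  fixes A :: "complex^'n^'n"
  shows "\<exists>ls. (\<forall>l\<in>set ls. eigenvalue_mat A l) \<and> fold (\<lambda>l w. A *v w - l *s w) ls v = 0"
proof -
  have "p \<noteq> 0 \<Longrightarrow> poly_matrix_vector A p v = 0 \<Longrightarrow>
    \<exists>ls. (\<forall>l\<in>set ls. eigenvalue_mat A l) \<and> fold (\<lambda>l w. A *v w - l *s w) ls v = 0" for p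
  proof (induction "degree p" arbitrary: p v rule: less_induct)
    case less
    show ?case
    proof (cases "\<exists>q. q \<noteq> 0 \<and> degree q < degree p \<and> poly_matrix_vector A q v = 0")
      case True
      then obtain q where "q \<noteq> 0" "degree q < degree p" "poly_matrix_vector A q v = 0" by metis
      then show ?thesis by (intro less.hyps[of q])
    next
      case minimal: False
      show ?thesis
      proof (cases "degree p = 0")
        case True
        then obtain c where "p = [:c:]" "c \<noteq> 0" using less.prems(1) by (metis degree_eq_zeroE pCons_0_0)
        then have "v = 0" using less.prems(2) by (simp add: poly_matrix_vector_def)
        then show ?thesis by (intro exI[of _ "[]"]) simp
      next
        case False
        then obtain l where "poly p l = 0"
          using fundamental_theorem_of_algebra[of p] constant_degree[of p] by auto
        then obtain q where p: "p = [:- l, 1:] * q" by (metis dvdE poly_eq_0_iff_dvd)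
        have q: "q \<noteq> 0" "degree q < degree p"
          using less.prems(1) unfolding p by (auto simp: degree_mult_eq simp del: mult_pCons_left)
        have ann: "poly_matrix_vector A q (A *v v - l *s v) = 0"
          using less.prems(2) unfolding p poly_matrix_vector_linear_factor .
        have "poly_matrix_vector A q v \<noteq> 0" using minimal q by blast
        moreover have "A *v poly_matrix_vector A q v = l *s poly_matrix_vector A q v"
          using matrix_poly_matrix_vector_commute[of A q v l] ann by simp
        ultimately have "eigenvalue_mat A l" unfolding eigenvalue_mat_def by blast
        moreover obtain ls where "\<forall>l\<in>set ls. eigenvalue_mat A l"
            "fold (\<lambda>l w. A *v w - l *s w) ls (A *v v - l *s v) = 0"
          using less.hyps[OF q(2) q(1) ann] by metis
        ultimately show ?thesis by (intro exI[of _ "l # ls"]) simp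
      qed
    qed
  qed
  then show ?thesis using exists_annihilating_poly[of A v] by metis
qed

text \<open>Factors are peeled off at the head of the list: the flow of (A - l I) v decays by
  induction, and it is the forcing term y in z' = l z + y for the flow z of v.\<close>

lemma flow_tendsto_0_complex:
  fixes A :: "complex^'n^'n"
  assumes "\<And>l. eigenvalue_mat A l \<Longrightarrow> Re l < 0"
  shows "((\<lambda>t. flow ((*v) A) t v) \<longlongrightarrow> 0) at_top"
proof -
  have "\<forall>l\<in>set ls. eigenvalue_mat A l \<Longrightarrow> fold (\<lambda>l w. A *v w - l *s w) ls v = 0 \<Longrightarrow>
      ((\<lambda>t. flow ((*v) A) t v) \<longlongrightarrow> 0) at_top" for ls
  proof (induction ls arbitrary: v)
    case Nil
    then show ?case by (simp add: flow_zero_vector)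
  next
    case (Cons l ls)
    have lin: "linear (\<lambda>w. A *v w - l *s w)"
    proof (rule linear_compose_sub[OF matrix_vector_mul_linear linearI])
      show "l *s (x + y) = l *s x + l *s y" for x y :: "complex^'n"
        by (rule vec.scale_right_distrib)
      show "l *s (r *\<^sub>R x) = r *\<^sub>R (l *s x)" for r and x :: "complex^'n"
        by (simp add: vec_eq_iff)
    qed
    have y: "flow ((*v) A) t (A *v v - l *s v)
        = A *v flow ((*v) A) t v - l *s flow ((*v) A) t v" for t
      using flow_bounded_linear_commute[OF matrix_vector_mul_linear lin, where g = "(*v) A" and v = v and t = t]
      by (simp add: vector_scalar_commute matrix_vector_mult_diff_distrib)
    show ?case
    proof (rule stable_scalar_equation_tendsto_0)
      show "Re l < 0" using Cons.prems assms by simp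
      show "((\<lambda>t. flow ((*v) A) t (A *v v - l *s v)) \<longlongrightarrow> 0) at_top"
        using Cons.prems by (intro Cons.IH) simp_all
      show "((\<lambda>t. flow ((*v) A) t v) has_vector_derivative
          l *s flow ((*v) A) t v + flow ((*v) A) t (A *v v - l *s v)) (at t)" for t
        unfolding y using flow_has_vector_derivative[OF matrix_vector_mul_linear, of A v t]
        by simp
    qed
  qed
  then show ?thesis using exists_annihilating_eigenvalues[of A v] by metis
qed

lemma hurwitz_flow_tendsto_0:
  fixes A :: "real^'n^'n"
  assumes "hurwitz A"
  shows "((\<lambda>t. flow ((*v) A) t v) \<longlongrightarrow> 0) at_top"
proof (rule vec_tendstoI)
  fix i
  define h :: "real^'n \<Rightarrow> complex^'n" where "h x = (\<chi> i. complex_of_real (x $ i))" for x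
  let ?A = "map_matrix complex_of_real A"
  have lin: "linear h"
    by (intro linearI) (simp_all add: h_def vec_eq_iff scaleR_conv_of_real[where 'a = complex])
  have comm: "h (A *v x) = ?A *v h x" for x
    by (simp add: h_def vec_eq_iff matrix_vector_mult_def map_matrix_def)
  have h: "h (flow ((*v) A) t v) = flow ((*v) ?A) t (h v)" for t
    by (rule flow_bounded_linear_commute[OF matrix_vector_mul_linear lin comm])
  have "((\<lambda>t. flow ((*v) ?A) t (h v)) \<longlongrightarrow> 0) at_top"
    using assms by (intro flow_tendsto_0_complex) (auto simp: hurwitz_def)
  then have "((\<lambda>t. Re (h (flow ((*v) A) t v) $ i)) \<longlongrightarrow> Re (0 $ i)) at_top"
    unfolding h by (intro tendsto_Re tendsto_vec_nth)
  then show "((\<lambda>t. flow ((*v) A) t v $ i) \<longlongrightarrow> 0 $ i) at_top"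
    by (simp add: h_def)
qed

section \<open>The Lyapunov operator\<close>

text \<open>Matrix identities are checked on bilinear forms, where a transpose merely exchanges the
  two arguments.\<close>

lemma matrix_eq_bilinear:
  fixes M N :: "real^'n^'m"
  shows "M = N \<longleftrightarrow> (\<forall>x y. x \<bullet> (M *v y) = x \<bullet> (N *v y))"
  unfolding matrix_eq using vector_eq_ldot by blast

lemma inner_vector_matrix_mult:
  fixes M :: "real^'n^'m"
  shows "y \<bullet> (x v* M) = x \<bullet> (M *v y)"
  by (metis dot_lmul_matrix inner_commute)

lemma inner_transpose_mult:
  fixes M :: "real^'n^'m"
  shows "y \<bullet> (transpose M *v x) = x \<bullet> (M *v y)"
  by (simp add: inner_vector_matrix_mult)

lemma inner_gram:
  fixes L :: "real^'n^'m"
  shows "x \<bullet> (L ** transpose L *v y) = (transpose L *v x) \<bullet> (transpose L *v y)"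
  by (metis inner_transpose_mult inner_commute matrix_vector_mul_assoc)

lemma inner_lyapunov_op:
  "x \<bullet> (lyapunov_op A X *v y) = (A *v x) \<bullet> (X *v y) + x \<bullet> (X *v (A *v y))"
proof -
  have "x \<bullet> (transpose A *v (X *v y)) = (A *v x) \<bullet> (X *v y)"
    by (metis inner_transpose_mult inner_commute)
  then show ?thesis
    unfolding lyapunov_op_def matrix_vector_mult_add_rdistrib inner_add_right
    by (simp only: matrix_vector_mul_assoc)
qed

lemma linear_lyapunov_op: "linear (lyapunov_op A)"
proof (rule linearI)
  show "lyapunov_op A (X + Y) = lyapunov_op A X + lyapunov_op A Y" for X Y
    unfolding matrix_eq_bilinear
    by (simp add: inner_lyapunov_op matrix_vector_mult_add_rdistrib inner_add_right)
  show "lyapunov_op A (r *\<^sub>R X) = r *\<^sub>R lyapunov_op A X" for r X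
    unfolding matrix_eq_bilinear
    by (simp add: inner_lyapunov_op scaleR_matrix_vector_assoc[symmetric] distrib_left)
qed

lemma lyapunov_op_transpose: "lyapunov_op A (transpose X) = transpose (lyapunov_op A X)"
  unfolding matrix_eq_bilinear inner_lyapunov_op inner_transpose_mult
  by (simp add: inner_commute)

text \<open>This ties the operator to the dynamics: nonnegativity and injectivity both follow by
  comparing the form at time 0 with its limit 0 at infinity.\<close>

lemma flow_bilinear_has_real_derivative:
  fixes A X :: "real^'n^'n"
  defines "x \<equiv> \<lambda>v t. flow ((*v) A) t v"
  shows "((\<lambda>t. x v t \<bullet> (X *v x w t)) has_real_derivative
    x v t \<bullet> (lyapunov_op A X *v x w t)) (at t)"
proof -
  have d: "(x v has_derivative (\<lambda>h. h *\<^sub>R (A *v x v t))) (at t)" for v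
    using flow_has_vector_derivative[OF matrix_vector_mul_linear]
    unfolding x_def has_vector_derivative_def .
  have "((\<lambda>t. X *v x w t) has_derivative (\<lambda>h. X *v (h *\<^sub>R (A *v x w t)))) (at t)"
    by (rule bounded_linear.has_derivative[OF matrix_vector_mul_bounded_linear d])
  from has_derivative_inner[OF d this]
  show ?thesis
    unfolding has_field_derivative_def inner_lyapunov_op
    by (rule has_derivative_eq_rhs) (auto simp: fun_eq_iff algebra_simps)
qed

lemma flow_bilinear_tendsto_0:
  fixes A X :: "real^'n^'n"
  assumes "hurwitz A"
  shows "((\<lambda>t. flow ((*v) A) t v \<bullet> (X *v flow ((*v) A) t w)) \<longlongrightarrow> 0) at_top"
proof -
  have "((\<lambda>t. flow ((*v) A) t v \<bullet> (X *v flow ((*v) A) t w)) \<longlongrightarrow> 0 \<bullet> (X *v 0)) at_top"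
    by (intro tendsto_inner hurwitz_flow_tendsto_0[OF assms]
        bounded_linear.tendsto[OF matrix_vector_mul_bounded_linear])
  then show ?thesis by simp
qed

text \<open>A function that does not increase and tends to 0 cannot start below 0.\<close>

lemma lyapunov_op_nonneg:
  assumes A: "hurwitz A" and le: "\<And>x. x \<bullet> (lyapunov_op A X *v x) \<le> 0"
  shows "0 \<le> v \<bullet> (X *v v)"
proof -
  define g where "g t = flow ((*v) A) t v \<bullet> (X *v flow ((*v) A) t v)" for t
  have "g t \<le> g 0" if "0 \<le> t" for t
    using flow_bilinear_has_real_derivative[where A = A and X = X and v = v and w = v] le
    by (intro DERIV_nonpos_imp_nonincreasing[OF that]) (auto simp: g_def)
  then have "\<forall>\<^sub>F t in at_top. g t \<le> g 0"
    unfolding eventually_at_top_linorder by blast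
  then have "0 \<le> g 0"
    by (intro tendsto_upperbound[OF flow_bilinear_tendsto_0[OF A, of v X v]])
      (auto simp: g_def)
  then show ?thesis by (simp add: g_def)
qed

text \<open>On the kernel the form is constant along the flow, hence equal to its limit 0. Two
  initial vectors are used because X is not known to be symmetric and its quadratic form would not
  determine it.\<close>

lemma inj_lyapunov_op:
  assumes A: "hurwitz A"
  shows "inj (lyapunov_op A)"
proof (subst linear_injective_0[OF linear_lyapunov_op], intro allI impI)
  fix X assume 0: "lyapunov_op A X = 0"
  have "v \<bullet> (X *v w) = 0" for v w
  proof -
    define g where "g t = flow ((*v) A) t v \<bullet> (X *v flow ((*v) A) t w)" for t
    have "(g has_real_derivative 0) (at t)" for t
      using flow_bilinear_has_real_derivative[where A = A and X = X and v = v and w = w and t = t] by (simp add: g_def[abs_def] 0)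
    then have "g t = g 0" for t
      by (intro DERIV_isconst_all) simp
    then have "(g \<longlongrightarrow> g 0) at_top"
      by (intro tendsto_eventually always_eventually allI)
    then have "g 0 = 0"
      using flow_bilinear_tendsto_0[OF A, of v X w] unfolding g_def[abs_def]
      by (intro tendsto_unique[OF trivial_limit_at_top_linorder])
    then show ?thesis by (simp add: g_def)
  qed
  then show "X = 0" by (simp add: matrix_eq_bilinear)
qed

lemma bij_lyapunov_op:
  assumes "hurwitz A"
  shows "bij (lyapunov_op A)"
  using inj_lyapunov_op[OF assms] linear_injective_imp_surjective[OF linear_lyapunov_op]
  by (auto simp: bij_def)

section \<open>Absolutely continuous functions\<close>

hide_const (open) Polynomial.content

lemma absolutely_continuous_on_intervalE:
  assumes "absolutely_continuous_on_interval a b f" "0 < e"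
  obtains \<delta> where "0 < \<delta>"
    "\<And>\<D> T. \<D> division_of T \<Longrightarrow> T \<subseteq> {a..b} \<Longrightarrow> (\<Sum>K\<in>\<D>. Sup K - Inf K) < \<delta> \<Longrightarrow>
      (\<Sum>K\<in>\<D>. norm (f (Sup K) - f (Inf K))) < e"
proof -
  obtain \<delta> where "0 < \<delta>" "\<forall>\<D> T. \<D> division_of T \<and> T \<subseteq> {a..b} \<and> (\<Sum>K\<in>\<D>. Sup K - Inf K) < \<delta> \<longrightarrow>
      (\<Sum>K\<in>\<D>. norm (f (Sup K) - f (Inf K))) < e"
    using assms unfolding absolutely_continuous_on_interval_def by blast
  then show ?thesis by (intro that[of \<delta>]) auto
qed

text \<open>A gauge integral argument. At tags off the null set N the derivative controls the
  increments. At tags in N the gauge confines the intervals to an open set of measure below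
  \<delta>, so absolute continuity bounds the sum of their increments; setting g to 0 on N removes
  their terms from the Riemann sum.\<close>

lemma fundamental_theorem_of_calculus_absolutely_continuous:
  fixes f f' :: "real \<Rightarrow> real"
  assumes ab: "a \<le> b"
    and ac: "absolutely_continuous_on_interval a b f"
    and deriv: "AE t in lebesgue. (f has_real_derivative f' t) (at t)"
  shows "(f' has_integral (f b - f a)) {a..b}"
proof -
  obtain N where N: "N \<in> null_sets lebesgue"
    and fN: "\<And>t. t \<notin> N \<Longrightarrow> (f has_real_derivative f' t) (at t)"
    using AE_E3[OF deriv] by auto
  define g where "g t = (if t \<in> N then 0 else f' t)" for t
  have "(g has_integral (f b - f a)) {a..b}"
    unfolding has_integral_real
  proof (intro allI impI)
    fix e :: real assume e: "0 < e"
    obtain \<delta> where \<delta>: "0 < \<delta>"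
      and ac\<delta>: "\<And>\<D> T. \<D> division_of T \<Longrightarrow> T \<subseteq> {a..b} \<Longrightarrow> (\<Sum>K\<in>\<D>. Sup K - Inf K) < \<delta> \<Longrightarrow>
        (\<Sum>K\<in>\<D>. norm (f (Sup K) - f (Inf K))) < e / 2"
      by (rule absolutely_continuous_on_intervalE[OF ac half_gt_zero[OF e]], rule that)
    have "N \<in> sets lebesgue" using N by auto
    then obtain U where U: "open U" "N \<subseteq> U" "U - N \<in> lmeasurable"
        "emeasure lebesgue (U - N) < ennreal \<delta>"
      using sets_lebesgue_outer_open \<delta> by metis
    have Um: "U \<in> lmeasurable"
    proof -
      have "N \<in> lmeasurable" using N by (rule fmeasurableI_null_sets)
      then show ?thesis using U(2,3) by (metis Diff_partition fmeasurable.Un)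
    qed
    \<comment> \<open>The errors at good tags add up to at most e' (b - a) <= e / 2; the summand 1
      covers a = b.\<close>
    define e' where "e' = e / (2 * (b - a + 1))"
    have e': "0 < e'" using e ab by (simp add: e'_def)
    have "\<exists>d>0. \<forall>y. \<bar>y - t\<bar> < d \<longrightarrow> \<bar>f y - f t - (y - t) * f' t\<bar> \<le> e' * \<bar>y - t\<bar>" if "t \<notin> N" for t
      using fN[OF that] e' unfolding has_field_derivative_def has_derivative_at_alt
      by (auto simp: mult.commute)
    then obtain d where d: "\<And>t. t \<notin> N \<Longrightarrow> 0 < d t"
        "\<And>t y. t \<notin> N \<Longrightarrow> \<bar>y - t\<bar> < d t \<Longrightarrow> \<bar>f y - f t - (y - t) * f' t\<bar> \<le> e' * \<bar>y - t\<bar>"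
      by metis
    define \<gamma> where "\<gamma> t = (if t \<in> N then U else ball t (d t))" for t
    have gauge: "gauge \<gamma>"
      unfolding gauge_def \<gamma>_def using U d(1) by auto
    have main: "norm ((\<Sum>(x, k)\<in>p. content k *\<^sub>R g x) - (f b - f a)) < e"
      if p: "p tagged_division_of {a..b}" "\<gamma> fine p" for p
    proof -
      define D where "D k = f (Sup k) - f (Inf k)" for k
      define pN where "pN = {(x, k)\<in>p. x \<in> N}"
      note pD = tagged_division_ofD[OF p(1)]
      have fin: "finite p" "finite pN" using pD(1) by (auto simp: pN_def intro: finite_subset)
      have intv: "\<exists>u v. k = {u..v} \<and> u \<le> x \<and> x \<le> v" if "(x, k) \<in> p" for x k
        using pD(2)[OF that] pD(4)[OF that] by auto
      have pNp: "pN \<subseteq> p" by (auto simp: pN_def)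
      have "p tagged_partial_division_of {a..b}"
        using p(1) by (simp add: tagged_division_of_def)
      from tagged_partial_division_of_Union_self[OF tagged_partial_division_subset[OF this pNp]]
      have tdN: "pN tagged_division_of \<Union>(snd ` pN)" .
      note divN = division_of_tagged_division[OF tdN]
      have kU: "k \<subseteq> U \<and> k \<subseteq> {a..b}" if "(x, k) \<in> pN" for x k
      proof -
        have "(x, k) \<in> p" "x \<in> N" using that by (auto simp: pN_def)
        moreover from this have "k \<subseteq> \<gamma> x" using p(2) unfolding fine_def by blast
        ultimately show ?thesis using pD(3) by (simp add: \<gamma>_def)
      qed
      have subN: "\<Union>(snd ` pN) \<subseteq> {a..b}" "\<Union>(snd ` pN) \<subseteq> U"
        by (auto dest!: kU)
      have meas: "measure lebesgue K = Sup K - Inf K" if K: "K \<in> snd ` pN" for K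
      proof -
        obtain x where "(x, K) \<in> pN" using K by auto
        then have "(x, K) \<in> p" using pNp by blast
        from intv[OF this] show ?thesis by auto
      qed
      have "(\<Sum>K\<in>snd ` pN. Sup K - Inf K) = measure lebesgue (\<Union>(snd ` pN))"
        using content_division[OF divN] meas by simp
      also have "\<dots> \<le> measure lebesgue U"
        using subN(2) lmeasurable_division[OF divN] Um by (intro measure_mono_fmeasurable) auto
      also have "\<dots> = measure lebesgue (U - N)"
        using measure_Diff_null_set[OF _ N, of U] Um by (simp add: fmeasurableD)
      also have "\<dots> < \<delta>"
        using U(3,4) \<delta> by (simp add: emeasure_eq_measure2 ennreal_less_iff)
      finally have "(\<Sum>K\<in>snd ` pN. norm (D K)) < e / 2"
        unfolding D_def by (rule ac\<delta>[OF divN subN(1)])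
      moreover have "(\<Sum>(x, k)\<in>pN. norm (D k)) = (\<Sum>K\<in>snd ` pN. norm (D K))"
      proof -
        \<comment> \<open>Several tags may carry the same interval only if it is degenerate, and
          there the increment is 0, so summing over tags or over intervals gives the same. The empty
          set is set to 0 by hand because its \<open>Sup\<close> and \<open>Inf\<close> are
          unspecified.\<close>
        define D' where "D' k = (if k = {} then 0 else norm (D k))" for k
        have ne: "k \<noteq> {}" if "(x, k) \<in> pN" for x k
          using pD(2)[of x k] that pNp by blast
        have "(\<Sum>(x, k)\<in>pN. norm (D k)) = (\<Sum>(x, k)\<in>pN. D' k)"
          using ne by (intro sum.cong) (auto simp: D'_def)
        also have "\<dots> = (\<Sum>K\<in>snd ` pN. D' K)"
        proof (rule sum.over_tagged_division_lemma[OF tdN])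
          fix u v :: real assume "box u v = {}"
          then show "D' (cbox u v) = 0" by (cases "u = v") (auto simp: D'_def D_def)
        qed
        also have "\<dots> = (\<Sum>K\<in>snd ` pN. norm (D K))"
          using ne by (intro sum.cong) (auto simp: D'_def)
        finally show ?thesis .
      qed
      ultimately have 1: "(\<Sum>(x, k)\<in>pN. norm (D k)) < e / 2" by simp
      have straddle: "\<bar>content k * f' x - D k\<bar> \<le> e' * content k" if xk: "(x, k) \<in> p" "x \<notin> N" for x k
      proof -
        obtain u v where k: "k = {u..v}" "u \<le> x" "x \<le> v" using intv[OF xk(1)] by blast
        have "k \<subseteq> \<gamma> x" using p(2) xk(1) unfolding fine_def by blast
        then have "k \<subseteq> ball x (d x)" using xk(2) by (simp add: \<gamma>_def)
        moreover have "u \<in> k" "v \<in> k" using k by auto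
        ultimately have "u \<in> ball x (d x)" "v \<in> ball x (d x)" by blast+
        then have "\<bar>u - x\<bar> < d x" "\<bar>v - x\<bar> < d x" by (auto simp: dist_real_def)
        then have "\<bar>f u - f x - (u - x) * f' x\<bar> \<le> e' * (x - u)"
            "\<bar>f v - f x - (v - x) * f' x\<bar> \<le> e' * (v - x)"
          using d(2)[OF xk(2), of u] d(2)[OF xk(2), of v] k by auto
        then show ?thesis using k by (simp add: D_def algebra_simps abs_le_iff)
      qed
      have "norm ((\<Sum>(x, k)\<in>p. content k *\<^sub>R g x) - (f b - f a))
          = norm (\<Sum>(x, k)\<in>p. content k * g x - D k)"
        unfolding additive_tagged_division_1[OF ab p(1), of f, symmetric]
        by (simp add: D_def sum_subtractf[symmetric] split_def)
      also have "\<dots> \<le> (\<Sum>(x, k)\<in>p. \<bar>content k * g x - D k\<bar>)"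
        using norm_sum[of "\<lambda>(x, k). content k * g x - D k" p] by (simp add: split_def)
      also have "\<dots> = (\<Sum>(x, k)\<in>pN. \<bar>content k * g x - D k\<bar>)
          + (\<Sum>(x, k)\<in>p - pN. \<bar>content k * g x - D k\<bar>)"
        using sum.subset_diff[OF pNp fin(1)] by (simp add: add.commute)
      finally have split: "norm ((\<Sum>(x, k)\<in>p. content k *\<^sub>R g x) - (f b - f a))
          \<le> (\<Sum>(x, k)\<in>pN. \<bar>content k * g x - D k\<bar>)
          + (\<Sum>(x, k)\<in>p - pN. \<bar>content k * g x - D k\<bar>)" .
      have eq: "(\<Sum>(x, k)\<in>pN. \<bar>content k * g x - D k\<bar>) = (\<Sum>(x, k)\<in>pN. norm (D k))"
        by (intro sum.cong) (auto simp: pN_def g_def)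
      have "(\<Sum>(x, k)\<in>p - pN. \<bar>content k * g x - D k\<bar>) \<le> (\<Sum>(x, k)\<in>p - pN. e' * content k)"
      proof (rule sum_mono, clarify)
        fix x k assume "(x, k) \<in> p" "(x, k) \<notin> pN"
        then show "\<bar>content k * g x - D k\<bar> \<le> e' * content k"
          using straddle[of x k] by (simp add: pN_def g_def)
      qed
      also have "\<dots> \<le> (\<Sum>(x, k)\<in>p. e' * content k)"
        using e' fin by (intro sum_mono2) auto
      also have "\<dots> = e' * (b - a)"
        using additive_content_tagged_division[of p a b] p(1) ab
        by (simp add: sum_distrib_left[symmetric] split_def)
      also have "\<dots> \<le> e / 2"
        using e ab by (simp add: e'_def field_simps)
      finally show ?thesis using split eq 1 by linarith
    qed
    show "\<exists>\<gamma>. gauge \<gamma> \<and> (\<forall>\<D>. \<D> tagged_division_of {a..b} \<and> \<gamma> fine \<D> \<longrightarrow>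
        norm ((\<Sum>(x, k)\<in>\<D>. content k *\<^sub>R g x) - (f b - f a)) < e)"
      by (intro exI[of _ \<gamma>] conjI gauge allI impI, elim conjE, rule main)
  qed
  moreover have "negligible N" using N by (simp add: negligible_iff_null_sets)
  ultimately show ?thesis
    by (intro has_integral_spike[of N "{a..b}" f' g]) (auto simp: g_def)
qed

lemma absolutely_continuous_on_interval_imp_continuous_on:
  assumes "absolutely_continuous_on_interval a b f"
  shows "continuous_on {a..b} f"
proof (unfold continuous_on_iff, intro ballI allI impI)
  fix x e :: real assume x: "x \<in> {a..b}" and e: "0 < e"
  obtain \<delta> where \<delta>: "0 < \<delta>"
    and ac: "\<And>\<D> T. \<D> division_of T \<Longrightarrow> T \<subseteq> {a..b} \<Longrightarrow> (\<Sum>K\<in>\<D>. Sup K - Inf K) < \<delta> \<Longrightarrow>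
      (\<Sum>K\<in>\<D>. norm (f (Sup K) - f (Inf K))) < e"
    by (rule absolutely_continuous_on_intervalE[OF assms e], rule that)
  have *: "norm (f v - f u) < e" if "u \<in> {a..b}" "v \<in> {a..b}" "u \<le> v" "v - u < \<delta>" for u v
    using ac[of "{cbox u v}" "cbox u v"] division_of_self[of u v] that by simp
  show "\<exists>d>0. \<forall>x'\<in>{a..b}. dist x' x < d \<longrightarrow> dist (f x') (f x) < e"
  proof (intro exI[of _ \<delta>] conjI \<delta> ballI impI)
    fix y assume y: "y \<in> {a..b}" "dist y x < \<delta>"
    then show "dist (f y) (f x) < e"
      using *[of x y] *[of y x] x
      by (cases "x \<le> y") (auto simp: dist_norm norm_minus_commute abs_if split: if_splits)
  qed
qed

text \<open>Used twice: a quadratic function of the state inherits absolute continuity from the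
  state, and a state with bounded velocity inherits it from the identity.\<close>

lemma absolutely_continuous_on_interval_Lipschitz:
  assumes f: "absolutely_continuous_on_interval a b f"
    and le: "\<And>s t. s \<in> {a..b} \<Longrightarrow> t \<in> {a..b} \<Longrightarrow> norm (g t - g s) \<le> K * norm (f t - f s)"
  shows "absolutely_continuous_on_interval a b g"
  unfolding absolutely_continuous_on_interval_def
proof (intro allI impI)
  fix e :: real assume e: "0 < e"
  define K' where "K' = max K 1"
  have K': "0 < K'" "K \<le> K'" by (auto simp: K'_def)
  obtain \<delta> where \<delta>: "0 < \<delta>"
    and ac: "\<And>\<D> T. \<D> division_of T \<Longrightarrow> T \<subseteq> {a..b} \<Longrightarrow> (\<Sum>K\<in>\<D>. Sup K - Inf K) < \<delta> \<Longrightarrow>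
      (\<Sum>K\<in>\<D>. norm (f (Sup K) - f (Inf K))) < e / K'"
    by (rule absolutely_continuous_on_intervalE[OF f divide_pos_pos[OF e K'(1)]], rule that)
  show "\<exists>\<delta>>0. \<forall>\<D> T. \<D> division_of T \<and> T \<subseteq> {a..b} \<and> (\<Sum>K\<in>\<D>. Sup K - Inf K) < \<delta> \<longrightarrow>
      (\<Sum>K\<in>\<D>. norm (g (Sup K) - g (Inf K))) < e"
  proof (intro exI[of _ \<delta>] conjI \<delta> allI impI, elim conjE)
    fix \<D> T assume D: "\<D> division_of T" "T \<subseteq> {a..b}" "(\<Sum>K\<in>\<D>. Sup K - Inf K) < \<delta>"
    have "norm (g (Sup J) - g (Inf J)) \<le> K' * norm (f (Sup J) - f (Inf J))" if JD: "J \<in> \<D>" for J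
    proof -
      obtain u v where J: "J = {u..v}" using division_ofD(4)[OF D(1) JD] by auto
      moreover have "J \<noteq> {}" "J \<subseteq> {a..b}" using division_ofD(2,3)[OF D(1) JD] D(2) by auto
      ultimately have "norm (g (Sup J) - g (Inf J)) \<le> K * norm (f (Sup J) - f (Inf J))"
        by (intro le) auto
      also have "\<dots> \<le> K' * norm (f (Sup J) - f (Inf J))" using K' by (intro mult_right_mono) auto
      finally show ?thesis .
    qed
    then have "(\<Sum>J\<in>\<D>. norm (g (Sup J) - g (Inf J))) \<le> K' * (\<Sum>J\<in>\<D>. norm (f (Sup J) - f (Inf J)))"
      unfolding sum_distrib_left by (rule sum_mono)
    also have "\<dots> < K' * (e / K')" using ac[OF D] K' by (intro mult_strict_left_mono) auto
    finally show "(\<Sum>J\<in>\<D>. norm (g (Sup J) - g (Inf J))) < e" using K' by simp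
  qed
qed

lemma absolutely_continuous_on_interval_id: "absolutely_continuous_on_interval a b (\<lambda>t::real. t)"
  unfolding absolutely_continuous_on_interval_def
proof (intro allI impI)
  fix e :: real assume e: "0 < e"
  show "\<exists>\<delta>>0. \<forall>\<D> T. \<D> division_of T \<and> T \<subseteq> {a..b} \<and> (\<Sum>K\<in>\<D>. Sup K - Inf K) < \<delta> \<longrightarrow>
      (\<Sum>K\<in>\<D>. norm (Sup K - Inf K)) < e"
  proof (intro exI[of _ e] conjI e allI impI, elim conjE)
    fix \<D> and T :: "real set"
    assume D: "\<D> division_of T" "(\<Sum>K\<in>\<D>. Sup K - Inf K) < e"
    have "norm (Sup J - Inf J) = Sup J - Inf J" if "J \<in> \<D>" for J
      using division_ofD(3)[OF D(1) that] division_ofD(4)[OF D(1) that] by auto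
    then show "(\<Sum>J\<in>\<D>. norm (Sup J - Inf J)) < e" using D(2) by simp
  qed
qed

section \<open>Quadratic storage functions\<close>

text \<open>Sorting by u and x exhibits the three blocks of the associated linear matrix inequality:
  D + D^T, C - B^T X and minus the Lyapunov image of X.\<close>

lemma dissipation_form:
  fixes A X :: "real^'n^'n" and B :: "real^'m^'n" and C :: "real^'n^'m" and D :: "real^'m^'m"
  assumes sym: "transpose X = X"
  shows "2 * (u \<bullet> (C *v x + D *v u)) - 2 * ((X *v x) \<bullet> (A *v x + B *v u))
    = u \<bullet> ((D + transpose D) *v u) + 2 * (u \<bullet> ((C - transpose B ** X) *v x))
      - x \<bullet> (lyapunov_op A X *v x)"
proof -
  have X: "a \<bullet> (X *v b) = (X *v a) \<bullet> b" for a b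
    by (metis inner_transpose_mult inner_commute sym)
  have 1: "u \<bullet> ((D + transpose D) *v u) = 2 * (u \<bullet> (D *v u))"
    by (simp add: matrix_vector_mult_add_rdistrib inner_add_right inner_vector_matrix_mult)
  have 2: "u \<bullet> ((transpose B ** X) *v x) = (X *v x) \<bullet> (B *v u)"
    by (metis inner_transpose_mult matrix_vector_mul_assoc)
  have 3: "x \<bullet> (lyapunov_op A X *v x) = 2 * ((X *v x) \<bullet> (A *v x))"
    using inner_commute[of "A *v x" "X *v x"] by (simp add: inner_lyapunov_op X)
  show ?thesis
    unfolding 1 3 matrix_vector_mult_diff_rdistrib inner_diff_right 2
    by (simp add: inner_add_right algebra_simps)
qed

lemma locally_absolutely_continuous_imp_continuous_on:
  assumes "locally_absolutely_continuous x"
  shows "continuous_on S x"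
proof -
  have "isCont x t" for t
  proof -
    have "continuous_on {t - 1..t + 1} x"
      using assms by (intro absolutely_continuous_on_interval_imp_continuous_on)
        (auto simp: locally_absolutely_continuous_def)
    then show ?thesis by (rule continuous_on_interior) simp
  qed
  then show ?thesis by (simp add: continuous_at_imp_continuous_on)
qed

text \<open>Continuity bounds x on the interval, which leaves terms linear and quadratic in |u|; the
  linear one is absorbed by |u| R c <= (R c)^2 + |u|^2.\<close>

lemma supply_rate_set_integrable:
  fixes C :: "real^'n^'m" and D :: "real^'m^'m"
  assumes u: "locally_square_integrable u" and x: "continuous_on UNIV x"
  shows "set_integrable lebesgue {a..b} (\<lambda>t. u t \<bullet> (C *v x t + D *v u t))"
proof -
  have "compact (x ` {a..b})"
    using x by (intro compact_continuous_image continuous_on_subset[OF x]) auto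
  then have "bounded (x ` {a..b})" by (rule compact_imp_bounded)
  then obtain R where R: "0 < R" "\<And>t. t \<in> {a..b} \<Longrightarrow> norm (x t) \<le> R"
    unfolding bounded_pos by blast
  obtain c where c: "0 < c" "\<And>v. norm (C *v v) \<le> norm v * c"
    using bounded_linear.pos_bounded[OF matrix_vector_mul_bounded_linear[of C]] by blast
  obtain d where d: "0 < d" "\<And>v. norm (D *v v) \<le> norm v * d"
    using bounded_linear.pos_bounded[OF matrix_vector_mul_bounded_linear[of D]] by blast
  have um: "u \<in> borel_measurable lebesgue"
    and uint: "set_integrable lebesgue {a..b} (\<lambda>t. (norm (u t))\<^sup>2)"
    using u by (auto simp: locally_square_integrable_def)
  have xm: "x \<in> borel_measurable lebesgue"
    using borel_measurable_continuous_onI[OF x] by (simp add: measurable_completion)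
  have "set_integrable lebesgue {a..b} (\<lambda>t. (R * c)\<^sup>2 + (1 + d) * (norm (u t))\<^sup>2)"
  proof (intro set_integral_add set_integrable_mult_right impI uint)
    show "set_integrable lebesgue {a..b} (\<lambda>t. (R * c)\<^sup>2)"
      unfolding set_integrable_def by (simp add: lmeasurable_iff_integrable[symmetric] fmeasurableD2)
  qed
  then show ?thesis
  proof (rule set_integrable_bound)
    have "(\<lambda>t. u t \<bullet> (C *v x t + D *v u t)) \<in> borel_measurable lebesgue"
    proof (intro borel_measurable_inner borel_measurable_add um)
      have Cm: "(*v) C \<in> borel_measurable borel" and Dm: "(*v) D \<in> borel_measurable borel"
        by (auto intro!: borel_measurable_continuous_onI linear_continuous_on)
      show "(\<lambda>t. C *v x t) \<in> borel_measurable lebesgue" by (rule measurable_compose[OF xm Cm])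
      show "(\<lambda>t. D *v u t) \<in> borel_measurable lebesgue" by (rule measurable_compose[OF um Dm])
    qed
    then show "set_borel_measurable lebesgue {a..b} (\<lambda>t. u t \<bullet> (C *v x t + D *v u t))"
      unfolding set_borel_measurable_def by (intro borel_measurable_scaleR borel_measurable_indicator) auto
    show "AE t in lebesgue. t \<in> {a..b} \<longrightarrow> norm (u t \<bullet> (C *v x t + D *v u t))
        \<le> norm ((R * c)\<^sup>2 + (1 + d) * (norm (u t))\<^sup>2)"
    proof (intro AE_I2 impI)
      fix t assume t: "t \<in> {a..b}"
      have "norm (u t \<bullet> (C *v x t + D *v u t)) \<le> norm (u t) * norm (C *v x t + D *v u t)"
        using Cauchy_Schwarz_ineq2 by simp
      also have "\<dots> \<le> norm (u t) * (R * c + norm (u t) * d)"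
      proof (rule mult_left_mono)
        have "norm (C *v x t) \<le> R * c"
          using c(2)[of "x t"] mult_right_mono[OF R(2)[OF t], of c] c(1) by linarith
        then show "norm (C *v x t + D *v u t) \<le> R * c + norm (u t) * d"
          using norm_triangle_ineq[of "C *v x t" "D *v u t"] d(2)[of "u t"] by linarith
      qed simp
      also have "\<dots> \<le> (R * c)\<^sup>2 + (1 + d) * (norm (u t))\<^sup>2"
      proof -
        have "norm (u t) * (R * c) \<le> (R * c)\<^sup>2 + (norm (u t))\<^sup>2"
        proof -
          have "0 \<le> norm (u t) * (R * c)" using R(1) c(1) by simp
          then show ?thesis using sum_squares_bound[of "norm (u t)" "R * c"] by linarith
        qed
        then show ?thesis by (simp add: algebra_simps power2_eq_square)
      qed
      also have "\<dots> \<le> norm ((R * c)\<^sup>2 + (1 + d) * (norm (u t))\<^sup>2)" by simp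
      finally show "norm (u t \<bullet> (C *v x t + D *v u t)) \<le> norm ((R * c)\<^sup>2 + (1 + d) * (norm (u t))\<^sup>2)" .
    qed
  qed
qed

lemma quadratic_form_has_real_derivative:
  fixes X :: "real^'n^'n"
  assumes sym: "transpose X = X" and x: "(x has_vector_derivative v) (at t)"
  shows "((\<lambda>t. x t \<bullet> (X *v x t) / 2) has_real_derivative (X *v x t) \<bullet> v) (at t)"
proof -
  have X: "a \<bullet> (X *v b) = (X *v a) \<bullet> b" for a b
    by (metis inner_transpose_mult inner_commute sym)
  note d = x[unfolded has_vector_derivative_def]
  have "((\<lambda>t. X *v x t) has_derivative (\<lambda>h. X *v (h *\<^sub>R v))) (at t)"
    by (rule bounded_linear.has_derivative[OF matrix_vector_mul_bounded_linear d])
  from has_derivative_inner[OF d this]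
  have "((\<lambda>t. x t \<bullet> (X *v x t)) has_real_derivative 2 * ((X *v x t) \<bullet> v)) (at t)"
    unfolding has_field_derivative_def
    by (rule has_derivative_eq_rhs)
      (simp add: fun_eq_iff X[of "x t"] inner_commute[of v "X *v x t"] matrix_vector_mult_scaleR)
  from DERIV_cdivide[OF this, of 2] show ?thesis by simp
qed

text \<open>On the bounded range of the state a quadratic form is Lipschitz, so V is absolutely
  continuous and is the integral of its derivative. The comparison with the supply takes place in
  the gauge integral, so Lebesgue integrability of V' need not be shown separately.\<close>

lemma quadratic_storage_function:
  fixes A X :: "real^'n^'n" and B :: "real^'m^'n" and C :: "real^'n^'m" and D :: "real^'m^'m"
  assumes sym: "transpose X = X" and nonneg: "\<And>x. 0 \<le> x \<bullet> (X *v x)"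
    and dissipative: "\<And>x u. (X *v x) \<bullet> (A *v x + B *v u) \<le> u \<bullet> (C *v x + D *v u)"
  shows "storage_function A B C D (\<lambda>x. x \<bullet> (X *v x) / 2)"
  unfolding storage_function_def
proof (rule conjI, simp add: nonneg, intro allI impI, elim conjE)
  fix u x y and t\<^sub>1 t\<^sub>2 :: real
  assume traj: "trajectory A B C D u x y" and le: "t\<^sub>1 \<le> t\<^sub>2"
  define V where "V t = x t \<bullet> (X *v x t) / 2" for t
  define V' where "V' t = (X *v x t) \<bullet> (A *v x t + B *v u t)" for t
  have u: "locally_square_integrable u" and lac: "locally_absolutely_continuous x"
    and deriv: "AE t in lebesgue. (x has_vector_derivative (A *v x t + B *v u t)) (at t)"
    and y: "y = (\<lambda>t. C *v x t + D *v u t)"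
    using traj by (auto simp: trajectory_def)
  have cont: "continuous_on S x" for S
    by (rule locally_absolutely_continuous_imp_continuous_on[OF lac])
  have X: "a \<bullet> (X *v b) = (X *v a) \<bullet> b" for a b
    by (metis inner_transpose_mult inner_commute sym)
  have "compact (x ` {t\<^sub>1..t\<^sub>2})"
    by (intro compact_continuous_image cont) auto
  then have "bounded (x ` {t\<^sub>1..t\<^sub>2})" by (rule compact_imp_bounded)
  then obtain R where R: "0 < R" "\<And>t. t \<in> {t\<^sub>1..t\<^sub>2} \<Longrightarrow> norm (x t) \<le> R"
    unfolding bounded_pos by blast
  obtain c where c: "0 < c" "\<And>v. norm (X *v v) \<le> norm v * c"
    using bounded_linear.pos_bounded[OF matrix_vector_mul_bounded_linear[of X]] by blast
  have "absolutely_continuous_on_interval t\<^sub>1 t\<^sub>2 V"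
  proof (rule absolutely_continuous_on_interval_Lipschitz)
    show "absolutely_continuous_on_interval t\<^sub>1 t\<^sub>2 x"
      using lac by (simp add: locally_absolutely_continuous_def)
    fix s t assume st: "s \<in> {t\<^sub>1..t\<^sub>2}" "t \<in> {t\<^sub>1..t\<^sub>2}"
    \<comment> \<open>A difference of squares: symmetry of X cancels the mixed terms.\<close>
    have "V t - V s = (x t - x s) \<bullet> (X *v (x t + x s)) / 2"
      using inner_commute[of "X *v x t" "x s"] X[of "x t" "x s"]
      by (simp add: V_def inner_diff_left inner_add_right matrix_vector_right_distrib
          diff_divide_distrib)
    then have "\<bar>V t - V s\<bar> = \<bar>(x t - x s) \<bullet> (X *v (x t + x s))\<bar> / 2" by (simp only: abs_divide abs_numeral)
    then have "norm (V t - V s) \<le> norm (x t - x s) * norm (X *v (x t + x s)) / 2"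
      using Cauchy_Schwarz_ineq2[of "x t - x s" "X *v (x t + x s)"] by simp
    also have "\<dots> \<le> norm (x t - x s) * ((R + R) * c) / 2"
    proof (intro divide_right_mono mult_left_mono)
      have "norm (x t + x s) \<le> R + R"
        using norm_triangle_ineq[of "x t" "x s"] R(2)[OF st(1)] R(2)[OF st(2)] by linarith
      then show "norm (X *v (x t + x s)) \<le> (R + R) * c"
        using c(2)[of "x t + x s"] mult_right_mono[of "norm (x t + x s)" "R + R" c] c(1) by linarith
    qed simp_all
    finally show "norm (V t - V s) \<le> (R * c) * norm (x t - x s)"
      by (simp add: mult_ac)
  qed
  moreover have "AE t in lebesgue. (V has_real_derivative V' t) (at t)"
    using deriv unfolding V_def[abs_def] V'_def
    by eventually_elim (rule quadratic_form_has_real_derivative[OF sym])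
  ultimately have "(V' has_integral (V t\<^sub>2 - V t\<^sub>1)) {t\<^sub>1..t\<^sub>2}"
    by (rule fundamental_theorem_of_calculus_absolutely_continuous[OF le])
  moreover have int: "set_integrable lebesgue {t\<^sub>1..t\<^sub>2} (\<lambda>t. u t \<bullet> y t)"
    unfolding y by (rule supply_rate_set_integrable[OF u cont])
  then have "((\<lambda>t. u t \<bullet> y t) has_integral (LINT t:{t\<^sub>1..t\<^sub>2}|lebesgue. u t \<bullet> y t)) {t\<^sub>1..t\<^sub>2}"
    by (rule has_integral_set_lebesgue)
  ultimately have "V t\<^sub>2 - V t\<^sub>1 \<le> (LINT t:{t\<^sub>1..t\<^sub>2}|lebesgue. u t \<bullet> y t)"
    by (rule has_integral_le) (use dissipative in \<open>simp add: V'_def y\<close>)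
  then show "x t\<^sub>2 \<bullet> (X *v x t\<^sub>2) / 2
      \<le> x t\<^sub>1 \<bullet> (X *v x t\<^sub>1) / 2 + (LINT t:{t\<^sub>1..t\<^sub>2}|lebesgue. u t \<bullet> y t)"
    by (simp add: V_def)
qed

text \<open>The three equations say precisely that the blocks of \<open>dissipation_form\<close> are
  those of the square |M^T u + L^T x|^2.\<close>

lemma kyp_identity:
  fixes A X :: "real^'n^'n" and B :: "real^'m^'n" and C :: "real^'n^'m" and D :: "real^'m^'m"
    and L :: "real^'k^'n" and M :: "real^'k^'m"
  assumes sym: "transpose X = X"
    and X: "lyapunov_op A X = - (L ** transpose L)"
    and C: "C = transpose B ** X + M ** transpose L"
    and D: "D + transpose D = M ** transpose M"
  shows "2 * (u \<bullet> (C *v x + D *v u)) - 2 * ((X *v x) \<bullet> (A *v x + B *v u))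
    = (norm (transpose M *v u + transpose L *v x))\<^sup>2"
proof -
  have 1: "x \<bullet> (lyapunov_op A X *v x) = - ((transpose L *v x) \<bullet> (transpose L *v x))"
    using matrix_vector_mult_diff_rdistrib[of 0 "L ** transpose L" x] inner_gram[of x L x]
    by (simp add: X)
  have "C - transpose B ** X = M ** transpose L" by (simp add: C)
  then have 2: "u \<bullet> ((C - transpose B ** X) *v x) = (transpose M *v u) \<bullet> (transpose L *v x)"
    by (metis inner_transpose_mult inner_commute matrix_vector_mul_assoc)
  show ?thesis
    unfolding dissipation_form[OF sym] 1 2 D inner_gram
    by (simp only: power2_norm_eq_inner) (simp add: inner_add_left inner_add_right inner_commute)
qed

lemma transpose_minus: "transpose (- M) = - transpose (M :: real^'n^'m)"
  by (simp add: transpose_def vec_eq_iff)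

lemma kyp_imp_passive:
  fixes A X :: "real^'n^'n" and B :: "real^'m^'n" and C :: "real^'n^'m" and D :: "real^'m^'m"
    and L :: "real^'k^'n" and M :: "real^'k^'m"
  assumes A: "hurwitz A"
    and X: "lyapunov_op A X = - (L ** transpose L)"
    and C: "C = transpose B ** X + M ** transpose L"
    and D: "D + transpose D = M ** transpose M"
  shows "is_passive A B C D"
proof -
  \<comment> \<open>The right-hand side of the Lyapunov equation is symmetric, so X and its
    transpose solve the same equation and uniqueness makes X symmetric.\<close>
  have "lyapunov_op A (transpose X) = lyapunov_op A X"
    by (simp add: lyapunov_op_transpose X transpose_minus matrix_transpose_mul)
  then have sym: "transpose X = X" using inj_lyapunov_op[OF A] by (simp add: inj_eq)
  have nonneg: "0 \<le> x \<bullet> (X *v x)" for x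
  proof (rule lyapunov_op_nonneg[OF A])
    show "x \<bullet> (lyapunov_op A X *v x) \<le> 0" for x
      using matrix_vector_mult_diff_rdistrib[of 0 "L ** transpose L" x] inner_gram[of x L x]
      by (simp add: X)
  qed
  have "(X *v x) \<bullet> (A *v x + B *v u) \<le> u \<bullet> (C *v x + D *v u)" for x u
    using kyp_identity[OF sym X C D, of u x]
      zero_le_power2[of "norm (transpose M *v u + transpose L *v x)"] by linarith
  then have "storage_function A B C D (\<lambda>x. x \<bullet> (X *v x) / 2)"
    by (intro quadratic_storage_function[OF sym nonneg])
  then show ?thesis unfolding is_passive_def by blast
qed

section \<open>Factorization of positive semidefinite matrices\<close>

lemma psd_form_Cauchy_Schwarz:
  fixes R :: "real^'m^'m"
  assumes sym: "transpose R = R" and psd: "\<And>x. 0 \<le> x \<bullet> (R *v x)"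
  shows "(x \<bullet> (R *v y))\<^sup>2 \<le> (x \<bullet> (R *v x)) * (y \<bullet> (R *v y))"
proof -
  define a b c where "a = y \<bullet> (R *v y)" and "b = x \<bullet> (R *v y)" and "c = x \<bullet> (R *v x)"
  have b: "y \<bullet> (R *v x) = b"
    unfolding b_def by (metis inner_transpose_mult sym)
  have *: "0 \<le> c + 2 * s * b + s\<^sup>2 * a" for s
  proof -
    have "(x + s *\<^sub>R y) \<bullet> (R *v (x + s *\<^sub>R y)) = c + s * b + s * (y \<bullet> (R *v x)) + s * s * a"
      by (simp add: a_def b_def c_def matrix_vector_right_distrib matrix_vector_mult_scaleR
          inner_add_left inner_add_right algebra_simps)
    then show ?thesis using psd[of "x + s *\<^sub>R y"] by (simp add: b power2_eq_square algebra_simps)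
  qed
  have "b\<^sup>2 \<le> c * a"
  proof (cases "a = 0")
    case True
    have "b = 0"
    proof (rule ccontr)
      assume "b \<noteq> 0"
      \<comment> \<open>With a = 0 the expression is affine in s, and at this s it equals
        -1.\<close>
      then show False using *[of "- (c + 1) / (2 * b)"] True by (simp add: field_simps)
    qed
    then show ?thesis using True by simp
  next
    case False
    then have "0 < a" using psd[of y] by (simp add: a_def)
    \<comment> \<open>The minimizer of the quadratic in s.\<close>
    then show ?thesis using *[of "- b / a"] by (simp add: field_simps power2_eq_square)
  qed
  then show ?thesis by (simp add: a_def b_def c_def)
qed

text \<open>Subtracting the rank-one form \<open>x \<mapsto> (v \<bullet> R x)\<^sup>2 / (v \<bullet> R v)\<close> enlarges the kernel by \<open>v\<close>; each step
  uses up one column of the factor.\<close>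

lemma psd_factorization_columns:
  fixes R :: "real^'m^'m"
  assumes "transpose R = R" and "\<And>x. 0 \<le> x \<bullet> (R *v x)"
    and "CARD('m) \<le> card J + dim {x. R *v x = 0}"
  shows "\<exists>M :: real^'m^'m. (\<forall>i j. j \<notin> J \<longrightarrow> M $ i $ j = 0) \<and> R = M ** transpose M"
  using finite[of J] assms
proof (induction J arbitrary: R rule: finite_induct)
  case empty
  let ?K = "{x. R *v x = 0}"
  have "subspace ?K"
    by (intro subspaceI) (simp_all add: matrix_vector_right_distrib matrix_vector_mult_scaleR)
  moreover have "dim ?K = DIM(real^'m)" using empty.prems(3) dim_subset_UNIV[of ?K] by simp
  ultimately have "?K = UNIV" using dim_eq_full[of ?K] span_eq_iff[of ?K] by simp
  then have "R = 0" by (auto simp: matrix_eq)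
  moreover have "(0 :: real^'m^'m) = 0 ** transpose 0" by (simp add: matrix_matrix_mult_def vec_eq_iff)
  ultimately show ?case by (intro exI[of _ 0]) simp
next
  case (insert j J)
  note sym = insert.prems(1) and psd = insert.prems(2)
  show ?case
  proof (cases "R = 0")
    case True
    moreover have "(0 :: real^'m^'m) = 0 ** transpose 0" by (simp add: matrix_matrix_mult_def vec_eq_iff)
    ultimately show ?thesis by (intro exI[of _ 0]) simp
  next
    case False
    have Rsym: "x \<bullet> (R *v y) = y \<bullet> (R *v x)" for x y
      by (metis inner_transpose_mult sym)
    \<comment> \<open>If all values of the quadratic form were 0, Cauchy-Schwarz would make the
      bilinear form vanish.\<close>
    obtain v where v: "v \<bullet> (R *v v) \<noteq> 0"
    proof (rule ccontr)
      assume "\<not> thesis"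
      then have "v \<bullet> (R *v v) = 0" for v using that by blast
      then have "x \<bullet> (R *v y) = 0" for x y
        using psd_form_Cauchy_Schwarz[OF sym psd, of x y] by simp
      then show False using False by (simp add: matrix_eq_bilinear)
    qed
    define a where "a = v \<bullet> (R *v v)"
    have a: "0 < a" using v psd[of v] by (simp add: a_def)
    \<comment> \<open>The normalization gives w . v = sqrt a and hence (w . v) w = R v, so
      subtracting w w^T kills v.\<close>
    define w where "w = (1 / sqrt a) *\<^sub>R (R *v v)"
    define S where "S = R - (\<chi> i k. w $ i * w $ k)"
    have outer: "(\<chi> i k. w $ i * w $ k) *v x = (w \<bullet> x) *\<^sub>R w" for x
      by (simp add: vec_eq_iff matrix_vector_mult_def inner_vec_def sum_distrib_left sum_distrib_right
          mult_ac)
    have S: "S *v x = R *v x - (w \<bullet> x) *\<^sub>R w" for x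
      by (simp add: S_def matrix_vector_mult_diff_rdistrib outer)
    have wx: "w \<bullet> x = (v \<bullet> (R *v x)) / sqrt a" for x
      by (simp add: w_def Rsym[of v x] inner_commute[of "R *v v"])
    have "transpose S = S"
    proof -
      have "R $ i $ k = R $ k $ i" for i k
        using arg_cong[OF sym, of "\<lambda>A. A $ k $ i"] by (simp add: transpose_def)
      then show ?thesis by (simp add: S_def transpose_def vec_eq_iff mult.commute)
    qed
    moreover have "0 \<le> x \<bullet> (S *v x)" for x
    proof -
      have "(w \<bullet> x) * (w \<bullet> x) = (v \<bullet> (R *v x))\<^sup>2 / a"
        using a by (simp add: wx power2_eq_square)
      also have "\<dots> \<le> x \<bullet> (R *v x)"
        using psd_form_Cauchy_Schwarz[OF sym psd, of v x] a
        by (simp add: field_simps a_def mult.commute)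
      finally show ?thesis by (simp add: S inner_diff_right inner_commute[of x w])
    qed
    moreover have "CARD('m) \<le> card J + dim {x. S *v x = 0}"
    proof -
      have vR: "R *v v \<noteq> 0" using v by auto
      have "v \<notin> span {x. R *v x = 0}"
      proof
        have "subspace {x. R *v x = 0}"
          by (intro subspaceI) (simp_all add: matrix_vector_right_distrib matrix_vector_mult_scaleR)
        moreover assume "v \<in> span {x. R *v x = 0}"
        ultimately show False using vR by (simp add: span_eq_iff[THEN iffD2])
      qed
      then have "Suc (dim {x. R *v x = 0}) = dim (insert v {x. R *v x = 0})"
        by (simp add: dim_insert)
      also have "\<dots> \<le> dim {x. S *v x = 0}"
      proof (rule dim_subset)
        have "w \<bullet> v = sqrt a"
          using a by (simp add: wx a_def[symmetric] real_div_sqrt)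
        then have "S *v v = 0"
          using a by (simp add: S w_def)
        moreover have "S *v x = 0" if "R *v x = 0" for x using that by (simp add: S wx)
        ultimately show "insert v {x. R *v x = 0} \<subseteq> {x. S *v x = 0}" by auto
      qed
      finally show ?thesis using insert.prems(3) insert.hyps by simp
    qed
    ultimately have "\<exists>N :: real^'m^'m. (\<forall>i k. k \<notin> J \<longrightarrow> N $ i $ k = 0) \<and> S = N ** transpose N"
      by (rule insert.IH)
    then obtain N :: "real^'m^'m" where N: "\<And>i k. k \<notin> J \<Longrightarrow> N $ i $ k = 0" "S = N ** transpose N"
      by auto
    \<comment> \<open>Column j, which is zero in N, receives w and so restores the subtracted
      rank-one form.\<close>
    define M where "M = (\<chi> i k. if k = j then w $ i else N $ i $ k)"
    have "(M ** transpose M) $ i $ k = R $ i $ k" for i k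
    proof -
      have "(M ** transpose M) $ i $ k = (\<Sum>l\<in>UNIV. (if l = j then w $ i * w $ k else 0) + N $ i $ l * N $ k $ l)"
        unfolding matrix_matrix_mult_def transpose_def M_def
        using N(1) insert.hyps by (auto intro!: sum.cong)
      also have "\<dots> = w $ i * w $ k + S $ i $ k"
        by (simp add: sum.distrib N(2) matrix_matrix_mult_def transpose_def)
      also have "\<dots> = R $ i $ k" by (simp add: S_def)
      finally show ?thesis .
    qed
    then have "R = M ** transpose M" by (simp add: vec_eq_iff)
    moreover have "\<forall>i k. k \<notin> insert j J \<longrightarrow> M $ i $ k = 0" using N(1) by (simp add: M_def)
    ultimately show ?thesis by (intro exI[of _ M] conjI)
  qed
qed

lemma psd_factorization:
  fixes R :: "real^'m^'m"
  assumes "transpose R = R" and "\<And>x. 0 \<le> x \<bullet> (R *v x)"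
  obtains M :: "real^'m^'m" where "R = M ** transpose M"
  using psd_factorization_columns[of R UNIV] assms by auto

section \<open>Solutions with bounded measurable inputs\<close>

text \<open>These solutions are closed under linear combination and concatenation and include all constant
  inputs, which is all that the available storage needs.\<close>

definition regular_solution ::
    "real^'n^'n \<Rightarrow> real^'m^'n \<Rightarrow> (real \<Rightarrow> real^'m) \<Rightarrow> (real \<Rightarrow> real^'n) \<Rightarrow> bool" where
  "regular_solution A B u x \<longleftrightarrow>
    u \<in> borel_measurable borel \<and> (\<forall>a b. bounded (u ` {a..b})) \<and> continuous_on UNIV x \<and>
    (\<exists>S. finite S \<and> (\<forall>t. t \<notin> S \<longrightarrow> (x has_vector_derivative (A *v x t + B *v u t)) (at t)))"

lemma regular_solutionE:
  assumes "regular_solution A B u x"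
  obtains S where "finite S" "\<And>t. t \<notin> S \<Longrightarrow> (x has_vector_derivative (A *v x t + B *v u t)) (at t)"
proof -
  have "\<exists>S. finite S \<and> (\<forall>t. t \<notin> S \<longrightarrow> (x has_vector_derivative (A *v x t + B *v u t)) (at t))"
    using assms by (simp add: regular_solution_def)
  then show ?thesis using that by (elim exE conjE) simp
qed

lemma regular_solutionD:
  assumes "regular_solution A B u x"
  shows "u \<in> borel_measurable borel" "bounded (u ` {a..b})" "continuous_on S x"
  using assms continuous_on_subset[of UNIV x S] by (simp_all add: regular_solution_def)

lemma regular_solution_bounded:
  assumes reg: "regular_solution A B u x"
  shows "bounded ((\<lambda>t. (u t, x t)) ` {a..b})"
proof -
  have "bounded (x ` {a..b})"
    by (intro compact_imp_bounded compact_continuous_image regular_solutionD(3)[OF reg]) auto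
  moreover have "bounded (u ` {a..b})" by (rule regular_solutionD(2)[OF reg])
  ultimately have "bounded ((u ` {a..b}) \<times> (x ` {a..b}))" by (intro bounded_Times)
  then show ?thesis by (rule bounded_subset) auto
qed

text \<open>The input may be discontinuous, so the range of (u, x) need not be closed; its closure
  is compact, and g is bounded there.\<close>

lemma regular_solution_set_integrable:
  fixes g :: "(real^'m) \<times> (real^'n) \<Rightarrow> 'a::euclidean_space"
  assumes reg: "regular_solution A B u x" and g: "continuous_on UNIV g"
  shows "set_integrable lebesgue {a..b} (\<lambda>t. g (u t, x t))"
proof -
  have "compact (closure ((\<lambda>t. (u t, x t)) ` {a..b}))"
    using regular_solution_bounded[OF reg] by (simp add: compact_closure)
  then have "compact (g ` closure ((\<lambda>t. (u t, x t)) ` {a..b}))"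
    by (intro compact_continuous_image continuous_on_subset[OF g]) auto
  then have "bounded (g ` closure ((\<lambda>t. (u t, x t)) ` {a..b}))" by (rule compact_imp_bounded)
  then obtain K where K: "\<And>p. p \<in> closure ((\<lambda>t. (u t, x t)) ` {a..b}) \<Longrightarrow> norm (g p) \<le> K"
    unfolding bounded_iff by blast
  have gK: "norm (g (u t, x t)) \<le> K" if "t \<in> {a..b}" for t
    by (intro K subsetD[OF closure_subset] imageI that)
  note um = regular_solutionD(1)[OF reg] and x = regular_solutionD(3)[OF reg]
  have "(\<lambda>t. (u t, x t)) \<in> borel_measurable borel"
    by (intro borel_measurable_Pair um borel_measurable_continuous_onI x)
  from measurable_compose[OF this borel_measurable_continuous_onI[OF g]]
  have "(\<lambda>t. g (u t, x t)) \<in> borel_measurable borel" .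
  then have m: "(\<lambda>t. g (u t, x t)) \<in> borel_measurable lebesgue"
    by (simp add: measurable_completion)
  have "set_integrable lebesgue {a..b} (\<lambda>t. K)"
    unfolding set_integrable_def by (simp add: lmeasurable_iff_integrable[symmetric] fmeasurableD2)
  then show ?thesis
  proof (rule set_integrable_bound)
    show "set_borel_measurable lebesgue {a..b} (\<lambda>t. g (u t, x t))"
      unfolding set_borel_measurable_def
      by (intro borel_measurable_scaleR borel_measurable_indicator m) auto
    show "AE t in lebesgue. t \<in> {a..b} \<longrightarrow> norm (g (u t, x t)) \<le> norm K"
      by (intro AE_I2 impI order_trans[OF gK]) auto
  qed
qed

lemma regular_solution_integrable:
  fixes g :: "(real^'m) \<times> (real^'n) \<Rightarrow> 'a::euclidean_space"
  assumes "regular_solution A B u x" "continuous_on UNIV g"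
  shows "(\<lambda>t. g (u t, x t)) integrable_on {a..b}"
  by (rule set_lebesgue_integral_eq_integral(1)[OF regular_solution_set_integrable[OF assms]])

lemma regular_solution_has_integral:
  assumes reg: "regular_solution A B u x" and ab: "a \<le> b"
  shows "((\<lambda>t. A *v x t + B *v u t) has_integral (x b - x a)) {a..b}"
proof -
  obtain S where S: "finite S" "\<And>t. t \<notin> S \<Longrightarrow> (x has_vector_derivative (A *v x t + B *v u t)) (at t)"
    by (rule regular_solutionE[OF reg], rule that)
  show ?thesis
    by (rule fundamental_theorem_of_calculus_interior_strong[OF S(1) ab S(2) regular_solutionD(3)[OF reg]])
      simp
qed

text \<open>On a bounded interval A x + B u is bounded, so x is Lipschitz and thus absolutely
  continuous; the finite exceptional set is null. Hence a storage function must respect these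
  solutions.\<close>

lemma regular_solution_trajectory:
  fixes A :: "real^'n^'n" and B :: "real^'m^'n"
  assumes reg: "regular_solution A B u x"
  shows "trajectory A B C D u x (\<lambda>t. C *v x t + D *v u t)"
  unfolding trajectory_def
proof (intro conjI allI)
  have um: "u \<in> borel_measurable borel" using reg by (simp add: regular_solution_def)
  have "set_integrable lebesgue {a..b} (\<lambda>t. (norm (u t))\<^sup>2)" for a b
    using regular_solution_set_integrable[OF reg, where g = "\<lambda>p. (norm (fst p))\<^sup>2"]
    by (simp add: continuous_intros)
  then show "locally_square_integrable u"
    using um by (simp add: locally_square_integrable_def measurable_completion)
  show "locally_absolutely_continuous x"
    unfolding locally_absolutely_continuous_def
  proof (intro allI)
    fix a b
    define F where "F p = A *v snd p + B *v fst p" for p :: "(real^'m) \<times> (real^'n)"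
    have "bounded_linear F"
      unfolding F_def[abs_def] by (intro bounded_linear_add
          bounded_linear_compose[OF matrix_vector_mul_bounded_linear] bounded_linear_fst bounded_linear_snd)
    then have "bounded (F ` (\<lambda>t. (u t, x t)) ` {a..b})"
      by (rule bounded_linear_image[OF regular_solution_bounded[OF reg]])
    then obtain K where K: "0 < K" "\<And>t. t \<in> {a..b} \<Longrightarrow> norm (A *v x t + B *v u t) \<le> K"
      unfolding bounded_pos F_def by auto
    have *: "norm (x t - x s) \<le> K * (t - s)" if "s \<in> {a..b}" "t \<in> {a..b}" "s \<le> t" for s t
      using has_integral_bound_real[of K "{}" "\<lambda>t. A *v x t + B *v u t" "x t - x s" s t]
        regular_solution_has_integral[OF reg that(3)] K that by auto
    show "absolutely_continuous_on_interval a b x"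
    proof (rule absolutely_continuous_on_interval_Lipschitz[OF absolutely_continuous_on_interval_id])
      fix s t :: real assume "s \<in> {a..b}" "t \<in> {a..b}"
      then show "norm (x t - x s) \<le> K * norm (t - s)"
        using *[of s t] *[of t s] by (cases "s \<le> t") (auto simp: norm_minus_commute)
    qed
  qed
  obtain S where S: "finite S" "\<And>t. t \<notin> S \<Longrightarrow> (x has_vector_derivative (A *v x t + B *v u t)) (at t)"
    by (rule regular_solutionE[OF reg], rule that)
  have "S \<in> null_sets lebesgue"
    using negligible_finite[OF S(1)] by (simp add: negligible_iff_null_sets)
  then have "AE t in lebesgue. t \<notin> S" by (rule AE_not_in)
  then show "AE t in lebesgue. (x has_vector_derivative (A *v x t + B *v u t)) (at t)"
    by eventually_elim (rule S(2))
qed simp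

lemma regular_solution_add:
  assumes "regular_solution A B u x" "regular_solution A B u' x'"
  shows "regular_solution A B (\<lambda>t. u t + u' t) (\<lambda>t. x t + x' t)"
proof -
  obtain S where S: "finite S" "\<And>t. t \<notin> S \<Longrightarrow> (x has_vector_derivative (A *v x t + B *v u t)) (at t)"
    by (rule regular_solutionE[OF assms(1)], rule that)
  obtain S' where S': "finite S'"
      "\<And>t. t \<notin> S' \<Longrightarrow> (x' has_vector_derivative (A *v x' t + B *v u' t)) (at t)"
    by (rule regular_solutionE[OF assms(2)], rule that)
  have "((\<lambda>t. x t + x' t) has_vector_derivative (A *v (x t + x' t) + B *v (u t + u' t))) (at t)"
    if "t \<notin> S \<union> S'" for t
    using has_vector_derivative_add[OF S(2) S'(2)] that
    by (simp add: matrix_vector_right_distrib algebra_simps)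
  moreover have "finite (S \<union> S')" using S(1) S'(1) by simp
  ultimately show ?thesis
    unfolding regular_solution_def
    by (intro conjI allI exI[of _ "S \<union> S'"] impI bounded_plus_comp continuous_on_add
        borel_measurable_add regular_solutionD[OF assms(1)] regular_solutionD[OF assms(2)])
qed

lemma regular_solution_scaleR:
  assumes "regular_solution A B u x"
  shows "regular_solution A B (\<lambda>t. r *\<^sub>R u t) (\<lambda>t. r *\<^sub>R x t)"
proof -
  obtain S where S: "finite S" "\<And>t. t \<notin> S \<Longrightarrow> (x has_vector_derivative (A *v x t + B *v u t)) (at t)"
    by (rule regular_solutionE[OF assms], rule that)
  have "((\<lambda>t. r *\<^sub>R x t) has_vector_derivative (A *v (r *\<^sub>R x t) + B *v (r *\<^sub>R u t))) (at t)"
    if "t \<notin> S" for t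
    using bounded_linear.has_vector_derivative[OF bounded_linear_scaleR_right S(2)[OF that], of r]
    by (simp add: matrix_vector_mult_scaleR scaleR_add_right)
  moreover have "bounded ((\<lambda>t. r *\<^sub>R u t) ` {a..b})" for a b
    using bounded_scaling[OF regular_solutionD(2)[OF assms], of r a b] by (simp add: image_image)
  ultimately show ?thesis
    unfolding regular_solution_def
    by (intro conjI allI exI[of _ S] impI S(1) continuous_on_scaleR borel_measurable_scaleR
        borel_measurable_const continuous_on_const regular_solutionD[OF assms])
qed

text \<open>By time invariance the second solution may be shifted to start at T; the exceptional set
  gains only T and the shifted exceptional times.\<close>

lemma regular_solution_concat:
  assumes "regular_solution A B u x" "regular_solution A B u' x'" and T: "x T = x' 0"
  shows "regular_solution A B (\<lambda>t. if t \<le> T then u t else u' (t - T))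
    (\<lambda>t. if t \<le> T then x t else x' (t - T))"
proof -
  let ?u = "\<lambda>t. if t \<le> T then u t else u' (t - T)"
  let ?x = "\<lambda>t. if t \<le> T then x t else x' (t - T)"
  obtain S where S: "finite S" "\<And>t. t \<notin> S \<Longrightarrow> (x has_vector_derivative (A *v x t + B *v u t)) (at t)"
    by (rule regular_solutionE[OF assms(1)], rule that)
  obtain S' where S': "finite S'"
      "\<And>t. t \<notin> S' \<Longrightarrow> (x' has_vector_derivative (A *v x' t + B *v u' t)) (at t)"
    by (rule regular_solutionE[OF assms(2)], rule that)
  note um = regular_solutionD(1)[OF assms(1)] regular_solutionD(1)[OF assms(2)]
    and xc = regular_solutionD(3)[OF assms(1)] regular_solutionD(3)[OF assms(2)]
    and ub = regular_solutionD(2)[OF assms(1)] regular_solutionD(2)[OF assms(2)]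
  have "(?x has_vector_derivative (A *v ?x t + B *v ?u t)) (at t)"
    if t: "t \<notin> S \<union> insert T ((\<lambda>s. s + T) ` S')" for t
  proof (cases "t < T")
    case True
    have "(?x has_vector_derivative (A *v x t + B *v u t)) (at t)"
      by (rule has_vector_derivative_transform_within_open[OF S(2), of t "{..<T}"])
        (use t True in auto)
    then show ?thesis using True by simp
  next
    case False
    then have tT: "T < t" using t by auto
    have "((\<lambda>t. t - T) has_real_derivative 1) (at t)"
      by (auto intro!: derivative_eq_intros)
    note shift = this[unfolded has_real_derivative_iff_has_vector_derivative]
    have "t - T \<notin> S'"
    proof
      assume "t - T \<in> S'"
      then have "(t - T) + T \<in> (\<lambda>s. s + T) ` S'" by (rule imageI)
      then show False using t by simp
    qed
    then have "((\<lambda>t. x' (t - T)) has_vector_derivative (A *v x' (t - T) + B *v u' (t - T))) (at t)"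
      using vector_diff_chain_at[of "\<lambda>t. t - T" 1 t x', OF shift S'(2)] by (simp add: o_def)
    then have "(?x has_vector_derivative (A *v x' (t - T) + B *v u' (t - T))) (at t)"
      by (rule has_vector_derivative_transform_within_open[of _ _ _ "{T<..}"]) (use tT in auto)
    then show ?thesis using tT by simp
  qed
  moreover have "finite (S \<union> insert T ((\<lambda>s. s + T) ` S'))" using S(1) S'(1) by simp
  moreover have "continuous_on UNIV ?x"
  proof (rule continuous_on_cases_le)
    show "continuous_on {t \<in> UNIV. t \<le> T} x" by (rule xc(1))
    show "continuous_on {t \<in> UNIV. T \<le> t} (\<lambda>t. x' (t - T))"
      by (rule continuous_on_compose2[OF xc(2)]) (auto intro!: continuous_intros)
  qed (use T in \<open>auto intro!: continuous_intros\<close>)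
  moreover have "?u \<in> borel_measurable borel"
    by (intro measurable_If um measurable_compose[OF _ um(2)]) auto
  moreover have "bounded (?u ` {a..b})" for a b
  proof -
    have "?u ` {a..b} \<subseteq> u ` {a..b} \<union> u' ` {a - T..b - T}" by auto
    moreover have "bounded (u ` {a..b} \<union> u' ` {a - T..b - T})" using ub by simp
    ultimately show ?thesis using bounded_subset by blast
  qed
  ultimately show ?thesis
    unfolding regular_solution_def
    by (intro conjI allI exI[of _ "S \<union> insert T ((\<lambda>s. s + T) ` S')"] impI)
qed

text \<open>Adjoining the input as a constant state gives the autonomous linear system (x, u)' = (A
  x + B u, 0), whose flow replaces the variation of constants formula.\<close>

lemma regular_solution_constant_input:
  fixes A :: "real^'n^'n" and B :: "real^'m^'n"
  shows "\<exists>x. regular_solution A B (\<lambda>t. u\<^sub>0) x \<and> x 0 = x\<^sub>0"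
proof -
  define f :: "(real^'n) \<times> (real^'m) \<Rightarrow> (real^'n) \<times> (real^'m)" where
    "f p = (A *v fst p + B *v snd p, 0)" for p
  have lin: "linear f"
    by (intro linearI) (auto simp: f_def matrix_vector_right_distrib matrix_vector_mult_scaleR
        algebra_simps)
  define z where "z t = flow f t (x\<^sub>0, u\<^sub>0)" for t
  have z: "(z has_vector_derivative f (z t)) (at t)" for t
    unfolding z_def[abs_def] by (rule flow_has_vector_derivative[OF lin])
  have fst: "((\<lambda>t. fst (z t)) has_vector_derivative fst (f (z t))) (at t)" for t
    using has_derivative_fst[OF z[of t, unfolded has_vector_derivative_def]]
    unfolding has_vector_derivative_def by simp
  have snd: "((\<lambda>t. snd (z t)) has_vector_derivative snd (f (z t))) (at t)" for t
    using has_derivative_snd[OF z[of t, unfolded has_vector_derivative_def]]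
    unfolding has_vector_derivative_def by simp
  have "snd (z t) = u\<^sub>0" for t
  proof -
    have "((\<lambda>t. snd (z t)) has_derivative (\<lambda>h. 0)) (at t within UNIV)" for t
      using snd[of t] by (simp add: has_vector_derivative_def f_def)
    then have "snd (z t) = snd (z 0)"
      using has_derivative_zero_unique[of UNIV "\<lambda>t. snd (z t)" t 0] by auto
    then show ?thesis by (simp add: z_def)
  qed
  then have "((\<lambda>t. fst (z t)) has_vector_derivative (A *v fst (z t) + B *v u\<^sub>0)) (at t)" for t
    using fst[of t] by (simp add: f_def)
  moreover from this have "continuous_on UNIV (\<lambda>t. fst (z t))"
    by (intro continuous_at_imp_continuous_on ballI has_vector_derivative_continuous)
  moreover have "bounded ((\<lambda>t. u\<^sub>0) ` {a..b})" for a b :: real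
    by (rule bounded_subset[of "{u\<^sub>0}"]) auto
  ultimately have "regular_solution A B (\<lambda>t. u\<^sub>0) (\<lambda>t. fst (z t))"
    unfolding regular_solution_def
    by (intro conjI allI exI[of _ "{}"] borel_measurable_const) simp_all
  moreover have "fst (z 0) = x\<^sub>0" by (simp add: z_def)
  ultimately show ?thesis by (intro exI[of _ "\<lambda>t. fst (z t)"] conjI)
qed

section \<open>The available storage\<close>

definition supplied ::
    "real^'n^'m \<Rightarrow> real^'m^'m \<Rightarrow> (real \<Rightarrow> real^'m) \<Rightarrow> (real \<Rightarrow> real^'n) \<Rightarrow> real \<Rightarrow> real" where
  "supplied C D u x T = integral {0..T} (\<lambda>t. u t \<bullet> (C *v x t + D *v u t))"

lemma supply_integrable:
  fixes A :: "real^'n^'n" and B :: "real^'m^'n"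
  assumes "regular_solution A B u x"
  shows "(\<lambda>t. u t \<bullet> (C *v x t + D *v u t)) integrable_on {a..b}"
proof -
  have "continuous_on UNIV (\<lambda>p :: (real^'m) \<times> (real^'n). fst p \<bullet> (C *v snd p + D *v fst p))"
    by (intro continuous_intros linear_continuous_on_compose[where f = snd]
        linear_continuous_on_compose[where f = fst] matrix_vector_mul_linear)
  from regular_solution_integrable[OF assms this] show ?thesis by simp
qed

lemma supply_has_integral:
  assumes "regular_solution A B u x"
  shows "((\<lambda>t. u t \<bullet> (C *v x t + D *v u t)) has_integral supplied C D u x T) {0..T}"
  unfolding supplied_def by (rule integrable_integral[OF supply_integrable[OF assms]])

lemma supply_concat:
  assumes reg: "regular_solution A B u x" "regular_solution A B u' x'" and T: "0 \<le> T" "0 \<le> S"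
  shows "supplied C D (\<lambda>t. if t \<le> T then u t else u' (t - T)) (\<lambda>t. if t \<le> T then x t else x' (t - T)) (T + S)
    = supplied C D u x T + supplied C D u' x' S"
proof -
  let ?f = "\<lambda>u x t. u t \<bullet> (C *v x t + D *v u t)"
  let ?u = "\<lambda>t. if t \<le> T then u t else u' (t - T)" and ?x = "\<lambda>t. if t \<le> T then x t else x' (t - T)"
  have "(?f ?u ?x has_integral supplied C D u x T) {0..T}"
    using supply_has_integral[OF reg(1)] by (rule has_integral_eq[rotated]) simp
  moreover have "(?f ?u ?x has_integral supplied C D u' x' S) {T..T + S}"
  \<comment> \<open>At t = T the concatenation still takes its first branch; a single point does not
    affect the integral.\<close>
  proof (rule has_integral_spike_finite[of "{T}"])
    show "((\<lambda>t. ?f u' x' (t - T)) has_integral supplied C D u' x' S) {T..T + S}"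
      using supply_has_integral[OF reg(2), of C D S]
        has_integral_shift_Icc_real[of "\<lambda>t. ?f u' x' (t - T)" T "supplied C D u' x' S" 0 S]
      by (simp add: o_def add.commute)
  qed auto
  ultimately have "(?f ?u ?x has_integral (supplied C D u x T + supplied C D u' x' S)) {0..T + S}"
    using T by (intro has_integral_combine[of 0 T]) auto
  then show ?thesis unfolding supplied_def by (rule integral_unique)
qed

text \<open>Zero input supplies no energy, so an extraction may idle. This brings two extractions to
  a common horizon, where they can be added.\<close>

lemma regular_solution_extend:
  fixes A :: "real^'n^'n" and B :: "real^'m^'n"
  assumes reg: "regular_solution A B u x" and T: "0 \<le> T" "T \<le> h"
  shows "\<exists>u' x'. regular_solution A B u' x' \<and> x' 0 = x 0 \<and> supplied C D u' x' h = supplied C D u x T"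
proof -
  obtain z where z: "regular_solution A B (\<lambda>t. 0) z" "z 0 = x T"
    using regular_solution_constant_input[of A B 0 "x T"] by auto
  have "supplied C D (\<lambda>t. 0) z (h - T) = 0" by (simp add: supplied_def)
  then have "supplied C D (\<lambda>t. if t \<le> T then u t else 0) (\<lambda>t. if t \<le> T then x t else z (t - T)) h
      = supplied C D u x T"
    using supply_concat[OF reg z(1) T(1), of "h - T" C D] T by simp
  then show ?thesis
    using regular_solution_concat[OF reg z(1) z(2)[symmetric]] T
    by (intro exI[of _ "\<lambda>t. if t \<le> T then u t else 0"]
        exI[of _ "\<lambda>t. if t \<le> T then x t else z (t - T)"] conjI) simp_all
qed

lemma supply_parallelogram:
  assumes reg: "regular_solution A B u x" "regular_solution A B u' x'"
  shows "supplied C D (\<lambda>t. u t + u' t) (\<lambda>t. x t + x' t) T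
      + supplied C D (\<lambda>t. u t - u' t) (\<lambda>t. x t - x' t) T
    = 2 * supplied C D u x T + 2 * supplied C D u' x' T"
proof -
  have "regular_solution A B (\<lambda>t. u t + (-1) *\<^sub>R u' t) (\<lambda>t. x t + (-1) *\<^sub>R x' t)"
    by (intro regular_solution_add regular_solution_scaleR reg)
  then have "regular_solution A B (\<lambda>t. u t - u' t) (\<lambda>t. x t - x' t)" by simp
  from has_integral_add[OF supply_has_integral[OF regular_solution_add[OF reg]] supply_has_integral[OF this]]
  have 1: "((\<lambda>t. (u t + u' t) \<bullet> (C *v (x t + x' t) + D *v (u t + u' t))
      + (u t - u' t) \<bullet> (C *v (x t - x' t) + D *v (u t - u' t))) has_integral
    (supplied C D (\<lambda>t. u t + u' t) (\<lambda>t. x t + x' t) T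
      + supplied C D (\<lambda>t. u t - u' t) (\<lambda>t. x t - x' t) T)) {0..T}" .
  have "(u t + u' t) \<bullet> (C *v (x t + x' t) + D *v (u t + u' t))
      + (u t - u' t) \<bullet> (C *v (x t - x' t) + D *v (u t - u' t))
    = 2 * (u t \<bullet> (C *v x t + D *v u t)) + 2 * (u' t \<bullet> (C *v x' t + D *v u' t))" for t
    by (simp add: matrix_vector_right_distrib matrix_vector_mult_diff_distrib inner_add_left
        inner_add_right inner_diff_left inner_diff_right algebra_simps)
  with 1 have 1: "((\<lambda>t. 2 * (u t \<bullet> (C *v x t + D *v u t)) + 2 * (u' t \<bullet> (C *v x' t + D *v u' t)))
      has_integral (supplied C D (\<lambda>t. u t + u' t) (\<lambda>t. x t + x' t) T
      + supplied C D (\<lambda>t. u t - u' t) (\<lambda>t. x t - x' t) T)) {0..T}" by simp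
  have "((\<lambda>t. 2 * (u t \<bullet> (C *v x t + D *v u t)) + 2 * (u' t \<bullet> (C *v x' t + D *v u' t)))
      has_integral (2 * supplied C D u x T + 2 * supplied C D u' x' T)) {0..T}"
    by (intro has_integral_add has_integral_mult_right supply_has_integral[OF reg(1)]
        supply_has_integral[OF reg(2)])
  from has_integral_unique[OF 1 this] show ?thesis .
qed

lemma supply_scaleR: "supplied C D (\<lambda>t. r *\<^sub>R u t) (\<lambda>t. r *\<^sub>R x t) T = r\<^sup>2 * supplied C D u x T"
proof -
  have "(r *\<^sub>R u t) \<bullet> (C *v (r *\<^sub>R x t) + D *v (r *\<^sub>R u t)) = r\<^sup>2 * (u t \<bullet> (C *v x t + D *v u t))" for t
    by (simp add: matrix_vector_mult_scaleR inner_add_right power2_eq_square algebra_simps)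
  then show ?thesis by (simp add: supplied_def)
qed

definition extractable ::
    "real^'n^'n \<Rightarrow> real^'m^'n \<Rightarrow> real^'n^'m \<Rightarrow> real^'m^'m \<Rightarrow> real^'n \<Rightarrow> real set" where
  "extractable A B C D \<xi> = {- supplied C D u x T | u x T. regular_solution A B u x \<and> x 0 = \<xi> \<and> 0 \<le> T}"

definition available_storage ::
    "real^'n^'n \<Rightarrow> real^'m^'n \<Rightarrow> real^'n^'m \<Rightarrow> real^'m^'m \<Rightarrow> real^'n \<Rightarrow> real" where
  "available_storage A B C D \<xi> = Sup (extractable A B C D \<xi>)"

text \<open>This bound is all that is kept of passivity; it makes the supremum in
  \<open>available_storage\<close> meaningful and survives the passage from D to D + e I with the
  same H.\<close>

locale bounded_extraction =
  fixes A :: "real^'n^'n" and B :: "real^'m^'n" and C :: "real^'n^'m" and D :: "real^'m^'m"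
    and H :: "real^'n \<Rightarrow> real"
  assumes extraction_le: "\<And>u x T. regular_solution A B u x \<Longrightarrow> 0 \<le> T \<Longrightarrow> - supplied C D u x T \<le> H (x 0)"
begin

abbreviation V :: "real^'n \<Rightarrow> real" where "V \<equiv> available_storage A B C D"

lemma extractableI:
  assumes "regular_solution A B u x" "0 \<le> T"
  shows "- supplied C D u x T \<in> extractable A B C D (x 0)"
  using assms unfolding extractable_def by blast

lemma extractable_bdd: "e \<in> extractable A B C D \<xi> \<Longrightarrow> e \<le> H \<xi>"
  unfolding extractable_def using extraction_le by auto

lemma extractable_0: "0 \<in> extractable A B C D \<xi>"
proof -
  obtain z where z: "regular_solution A B (\<lambda>t. 0) z" "z 0 = \<xi>"
    using regular_solution_constant_input[of A B 0 \<xi>] by auto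
  have "supplied C D (\<lambda>t. 0) z 0 = 0" by (simp add: supplied_def)
  then show ?thesis using extractableI[OF z(1), of 0] z(2) by simp
qed

lemma available_storage_upper:
  assumes "regular_solution A B u x" "0 \<le> T"
  shows "- supplied C D u x T \<le> V (x 0)"
  unfolding available_storage_def
  by (rule cSup_upper[OF extractableI[OF assms] bdd_aboveI[OF extractable_bdd]])

lemma available_storage_nonneg: "0 \<le> V \<xi>"
  unfolding available_storage_def
  by (rule cSup_upper[OF extractable_0 bdd_aboveI[OF extractable_bdd]])

lemma available_storage_le: "V \<xi> \<le> H \<xi>"
  unfolding available_storage_def
  by (rule cSup_least) (use extractable_0 extractable_bdd in auto)

lemma available_storage_approx:
  assumes "0 < e"
  obtains u x T where "regular_solution A B u x" "x 0 = \<xi>" "0 \<le> T" "V \<xi> - e < - supplied C D u x T"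
proof -
  have "V \<xi> - e < Sup (extractable A B C D \<xi>)" using assms by (simp add: available_storage_def)
  from less_cSupD[OF _ this] extractable_0
  obtain y where "y \<in> extractable A B C D \<xi>" "V \<xi> - e < y" by blast
  then show ?thesis using that unfolding extractable_def by auto
qed

text \<open>Dynamic programming: following the given solution up to time h and then any extraction
  from x h is itself an extraction from x 0.\<close>

lemma available_storage_dissipation:
  assumes reg: "regular_solution A B u x" and h: "0 \<le> h"
  shows "V (x h) \<le> V (x 0) + supplied C D u x h"
proof -
  have "e \<le> V (x 0) + supplied C D u x h" if e: "e \<in> extractable A B C D (x h)" for e
  proof -
    obtain u' x' T where 1: "regular_solution A B u' x'" "x' 0 = x h" "0 \<le> T" "e = - supplied C D u' x' T"
      using e unfolding extractable_def by auto
    have "- supplied C D (\<lambda>t. if t \<le> h then u t else u' (t - h)) (\<lambda>t. if t \<le> h then x t else x' (t - h)) (h + T)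
        \<le> V (x 0)"
      using available_storage_upper[OF regular_solution_concat[OF reg 1(1) 1(2)[symmetric]], of "h + T"] h 1(3)
      by simp
    then show ?thesis using supply_concat[OF reg 1(1) h 1(3), of C D] 1(4) by simp
  qed
  then show ?thesis
    unfolding available_storage_def[of A B C D "x h"]
    using extractable_0 by (intro cSup_least) auto
qed

text \<open>The sum and the difference of nearly optimal extractions from a and b are admissible
  from a + b and a - b. Each defect e / 4 enters with factor 2.\<close>

lemma available_storage_parallelogram_le:
  "2 * V a + 2 * V b \<le> V (a + b) + V (a - b)"
proof (rule field_le_epsilon)
  fix e :: real assume e: "0 < e"
  then have e4: "0 < e / 4" by simp
  obtain u x T where 1: "regular_solution A B u x" "x 0 = a" "0 \<le> T" "V a - e / 4 < - supplied C D u x T"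
    by (rule available_storage_approx[OF e4, of a])
  obtain u' x' T' where 2: "regular_solution A B u' x'" "x' 0 = b" "0 \<le> T'" "V b - e / 4 < - supplied C D u' x' T'"
    by (rule available_storage_approx[OF e4, of b])
  define h where "h = max T T'"
  obtain v z where 3: "regular_solution A B v z" "z 0 = a" "supplied C D v z h = supplied C D u x T"
    using regular_solution_extend[OF 1(1,3), of h C D] 1(2) by (auto simp: h_def)
  obtain v' z' where 4: "regular_solution A B v' z'" "z' 0 = b" "supplied C D v' z' h = supplied C D u' x' T'"
    using regular_solution_extend[OF 2(1,3), of h C D] 2(2) by (auto simp: h_def)
  have h: "0 \<le> h" using 1(3) by (simp add: h_def)
  have "regular_solution A B (\<lambda>t. v t + (-1) *\<^sub>R v' t) (\<lambda>t. z t + (-1) *\<^sub>R z' t)"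
    by (intro regular_solution_add regular_solution_scaleR 3(1) 4(1))
  then have "regular_solution A B (\<lambda>t. v t - v' t) (\<lambda>t. z t - z' t)" by simp
  from available_storage_upper[OF this h]
    available_storage_upper[OF regular_solution_add[OF 3(1) 4(1)] h]
  show "2 * V a + 2 * V b \<le> V (a + b) + V (a - b) + e"
    using supply_parallelogram[OF 3(1) 4(1), of C D h] 1(4) 2(4) 3 4 by simp
qed

lemma available_storage_scaleR_ge: "r\<^sup>2 * V \<xi> \<le> V (r *\<^sub>R \<xi>)"
proof (rule field_le_epsilon)
  fix e :: real assume e: "0 < e"
  \<comment> \<open>Dividing e by r^2 + 1 instead of r^2 covers r = 0, and the resulting factor r^2
    / (r^2 + 1) is still at most 1.\<close>
  have r: "0 < r\<^sup>2 + 1" using zero_le_power2[of r] by linarith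
  obtain u x T where 1: "regular_solution A B u x" "x 0 = \<xi>" "0 \<le> T"
      "V \<xi> - e / (r\<^sup>2 + 1) < - supplied C D u x T"
    by (rule available_storage_approx[OF divide_pos_pos[OF e r], of \<xi>])
  have "r\<^sup>2 * (V \<xi> - e / (r\<^sup>2 + 1)) \<le> r\<^sup>2 * (- supplied C D u x T)"
    using 1(4) by (intro mult_left_mono) auto
  also have "\<dots> \<le> V (r *\<^sub>R \<xi>)"
    using available_storage_upper[OF regular_solution_scaleR[OF 1(1), of r] 1(3)] 1(2)
    by (simp add: supply_scaleR)
  finally have "r\<^sup>2 * V \<xi> - r\<^sup>2 / (r\<^sup>2 + 1) * e \<le> V (r *\<^sub>R \<xi>)" by (simp add: algebra_simps)
  moreover have "r\<^sup>2 / (r\<^sup>2 + 1) * e \<le> 1 * e" using e r by (intro mult_right_mono) auto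
  ultimately show "r\<^sup>2 * V \<xi> \<le> V (r *\<^sub>R \<xi>) + e" by linarith
qed

lemma available_storage_scaleR: "V (r *\<^sub>R \<xi>) = r\<^sup>2 * V \<xi>"
proof (cases "r = 0")
  case True
  \<comment> \<open>Scaling by 2 gives 4 V 0 <= V 0.\<close>
  have "V 0 = 0" using available_storage_scaleR_ge[of 2 0] available_storage_nonneg[of 0] by simp
  then show ?thesis using True by simp
next
  case False
  then have "V (r *\<^sub>R \<xi>) / r\<^sup>2 \<le> V \<xi>"
    using available_storage_scaleR_ge[of "1 / r" "r *\<^sub>R \<xi>"] by (simp add: power_one_over)
  then have "V (r *\<^sub>R \<xi>) \<le> r\<^sup>2 * V \<xi>" using False by (simp add: field_simps)
  then show ?thesis using available_storage_scaleR_ge[of r \<xi>] by simp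
qed

text \<open>The reverse inequality is the known one at a + b and a - b, whose sum and difference are
  2 a and 2 b, combined with quadratic scaling.\<close>

lemma available_storage_parallelogram: "V (a + b) + V (a - b) = 2 * V a + 2 * V b"
proof -
  have "2 * V (a + b) + 2 * V (a - b) \<le> V (2 *\<^sub>R a) + V (2 *\<^sub>R b)"
    using available_storage_parallelogram_le[of "a + b" "a - b"] by (simp add: scaleR_2)
  then show ?thesis
    using available_storage_parallelogram_le[of a b] by (simp add: available_storage_scaleR)
qed

end

section \<open>From the parallelogram law to a quadratic form\<close>

lemma additive_locally_bounded_linear:
  fixes f :: "real \<Rightarrow> real"
  assumes add: "\<And>r s. f (r + s) = f r + f s" and bounded: "\<And>r. \<bar>r\<bar> \<le> 1 \<Longrightarrow> \<bar>f r\<bar> \<le> K"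
  shows "f r = r * f 1"
proof -
  \<comment> \<open>An additive function vanishing at 1 is periodic with period 1, hence bounded
    everywhere by its bound on [0, 1); then all multiples n g(r) are bounded, which forces g =
    0.\<close>
  define g where "g r = f r - r * f 1" for r
  have g_add: "g (r + s) = g r + g s" for r s by (simp add: g_def add algebra_simps)
  have g0: "g 0 = 0" using g_add[of 0 0] by simp
  have gneg: "g (- r) = - g r" for r using g_add[of r "- r"] g0 by simp
  have g_nat_mult: "g (real n * r) = real n * g r" for n r
    by (induction n) (simp_all add: g0 g_add algebra_simps)
  have "g 1 = 0" by (simp add: g_def)
  then have g_nat: "g (real n) = 0" for n using g_nat_mult[of n 1] by simp
  have g_int: "g (real_of_int k) = 0" for k
    by (cases k rule: int_cases2) (simp_all add: g_nat gneg)
  have bound: "\<bar>g r\<bar> \<le> K + \<bar>f 1\<bar>" for r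
  proof -
    have "g r = g (real_of_int \<lfloor>r\<rfloor>) + g (frac r)" by (simp add: g_add[symmetric] frac_def)
    moreover have f01: "\<bar>frac r\<bar> \<le> 1" using frac_ge_0[of r] frac_lt_1[of r] by linarith
    moreover have "\<bar>frac r * f 1\<bar> \<le> \<bar>f 1\<bar>"
      using mult_right_mono[OF f01, of "\<bar>f 1\<bar>"] by (simp add: abs_mult)
    ultimately show ?thesis using bounded[OF f01] g_int by (simp add: g_def)
  qed
  have "g r = 0"
  proof (rule ccontr)
    assume "g r \<noteq> 0"
    then obtain n where "K + \<bar>f 1\<bar> < real n * \<bar>g r\<bar>" using reals_Archimedean3 by (metis zero_less_abs_iff)
    then show False using bound[of "real n * r"] by (simp add: g_nat_mult abs_mult)
  qed
  then show ?thesis by (simp add: g_def)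
qed

text \<open>The Jordan--von Neumann argument; nonnegativity replaces continuity.\<close>

lemma parallelogram_imp_quadratic:
  fixes V :: "real^'n \<Rightarrow> real"
  assumes nonneg: "\<And>a. 0 \<le> V a"
    and par: "\<And>a b. V (a + b) + V (a - b) = 2 * V a + 2 * V b"
    and scale: "\<And>r a. V (r *\<^sub>R a) = r\<^sup>2 * V a"
  obtains X :: "real^'n^'n" where "transpose X = X" "\<And>a. V a = a \<bullet> (X *v a) / 2"
proof -
  define b where "b x z = (V (x + z) - V (x - z)) / 4" for x z
  have neg: "V (- a) = V a" for a using scale[of "-1" a] by simp
  have comm: "b x z = b z x" for x z
    using neg[of "x - z"] by (simp add: b_def add.commute)
  have V0: "V 0 = 0" using scale[of 0 0] by simp
  \<comment> \<open>The law is applied to (x + z, y + z) and (x - z, y - z); in both cases the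
    difference is x - y, so those terms cancel.\<close>
  have half: "b x z + b y z = b (x + y) (2 *\<^sub>R z) / 2" for x y z
  proof -
    have eq: "x + z + (y + z) = x + y + 2 *\<^sub>R z" "x - z + (y - z) = x + y - 2 *\<^sub>R z"
        "x + z - (y + z) = x - y" "x - z - (y - z) = x - y"
      by (simp_all add: scaleR_2)
    show ?thesis
      using par[of "x + z" "y + z"] par[of "x - z" "y - z"] unfolding eq b_def by argo
  qed
  have "b 0 z = 0" for z using neg[of z] by (simp add: b_def)
  then have double: "b x z = b x (2 *\<^sub>R z) / 2" for x z using half[of x z 0] by simp
  have add: "b (x + y) z = b x z + b y z" for x y z using half[of x z y] double[of "x + y" z] by simp
  \<comment> \<open>V(x + z) and V(x - z) are nonnegative with sum 2 V x + 2 V z, so their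
    difference is at most that sum in absolute value. This is the local boundedness that yields
    homogeneity.\<close>
  have bound: "\<bar>b x z\<bar> \<le> (V x + V z) / 2" for x z
    using par[of x z] nonneg[of "x + z"] nonneg[of "x - z"]
    unfolding b_def by - (rule abs_leI; argo)
  have scaleb: "b (r *\<^sub>R x) z = r * b x z" for r x z
  proof -
    have "b (r *\<^sub>R x) z = r * b (1 *\<^sub>R x) z"
    proof (rule additive_locally_bounded_linear)
      show "b ((r + s) *\<^sub>R x) z = b (r *\<^sub>R x) z + b (s *\<^sub>R x) z" for r s
        by (simp add: scaleR_add_left add)
      fix r :: real assume "\<bar>r\<bar> \<le> 1"
      then have "r\<^sup>2 \<le> 1" by (simp add: abs_square_le_1)
      then have "r\<^sup>2 * V x \<le> 1 * V x" using nonneg by (intro mult_right_mono)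
      then show "\<bar>b (r *\<^sub>R x) z\<bar> \<le> (V x + V z) / 2"
        using bound[of "r *\<^sub>R x" z] by (simp add: scale)
    qed
    then show ?thesis by simp
  qed
  have lin1: "linear (\<lambda>x. b x z)" for z by (intro linearI) (simp_all add: add scaleb)
  have lin2: "linear (\<lambda>z. b x z)" for x using lin1[of x] by (simp add: comm[of x])
  \<comment> \<open>Twice the Gram matrix of b, to match V a = a . X a / 2.\<close>
  define X :: "real^'n^'n" where "X = (\<chi> i k. 2 * b (axis i 1) (axis k 1))"
  have V_b: "V a = b a a" for a using scale[of 2 a] by (simp add: b_def V0 scaleR_2)
  have X: "2 * b x z = x \<bullet> (X *v z)" for x z
  proof -
    have exp: "x = (\<Sum>i\<in>UNIV. x $ i *\<^sub>R axis i 1)" for x :: "real^'n"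
      by (simp add: vec_eq_iff axis_def if_distrib[of "\<lambda>c. _ * c"] cong: if_cong)
    have "b x z = (\<Sum>i\<in>UNIV. x $ i * b (axis i 1) z)"
      by (subst exp[of x]) (simp add: linear_sum[OF lin1] scaleb)
    also have "\<dots> = (\<Sum>i\<in>UNIV. x $ i * (\<Sum>k\<in>UNIV. z $ k * b (axis i 1) (axis k 1)))"
    proof (rule sum.cong[OF refl])
      fix i
      have "b (axis i 1) z = (\<Sum>k\<in>UNIV. z $ k * b (axis i 1) (axis k 1))"
        by (subst exp[of z]) (simp add: linear_sum[OF lin2] linear_scale[OF lin2])
      then show "x $ i * b (axis i 1) z = x $ i * (\<Sum>k\<in>UNIV. z $ k * b (axis i 1) (axis k 1))"
        by simp
    qed
    finally show ?thesis
      by (simp add: X_def inner_vec_def matrix_vector_mult_def sum_distrib_left mult_ac)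
  qed
  have "V a = a \<bullet> (X *v a) / 2" for a using X[of a a] V_b[of a] by simp
  moreover have "transpose X = X" by (simp add: X_def transpose_def vec_eq_iff comm)
  ultimately show ?thesis by (intro that)
qed

section \<open>The Riccati equation of the available storage\<close>

lemma regular_quadratic_has_integral:
  fixes X :: "real^'n^'n"
  assumes sym: "transpose X = X" and reg: "regular_solution A B u x" and ab: "a \<le> b"
  shows "((\<lambda>t. (X *v x t) \<bullet> (A *v x t + B *v u t)) has_integral
    (x b \<bullet> (X *v x b) / 2 - x a \<bullet> (X *v x a) / 2)) {a..b}"
proof -
  obtain S where S: "finite S" "\<And>t. t \<notin> S \<Longrightarrow> (x has_vector_derivative (A *v x t + B *v u t)) (at t)"
    by (rule regular_solutionE[OF reg], rule that)
  show ?thesis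
  proof (rule fundamental_theorem_of_calculus_interior_strong[OF S(1) ab])
    fix t assume "t \<in> {a<..<b} - S"
    then have "(x has_vector_derivative (A *v x t + B *v u t)) (at t)" by (intro S(2)) simp
    from quadratic_form_has_real_derivative[OF sym this]
    show "((\<lambda>t. x t \<bullet> (X *v x t) / 2) has_vector_derivative (X *v x t) \<bullet> (A *v x t + B *v u t)) (at t)"
      by (simp add: has_real_derivative_iff_has_vector_derivative)
  next
    show "continuous_on {a..b} (\<lambda>t. x t \<bullet> (X *v x t) / 2)"
      by (intro continuous_intros regular_solutionD(3)[OF reg] matrix_vector_mul_linear
          linear_continuous_on_compose[OF regular_solutionD(3)[OF reg]]) simp
  qed
qed

definition dissipation_rate ::
    "real^'n^'n \<Rightarrow> real^'m^'n \<Rightarrow> real^'n^'m \<Rightarrow> real^'m^'m \<Rightarrow> real^'n^'n \<Rightarrow> real^'n \<Rightarrow> real^'m \<Rightarrow> real" where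
  "dissipation_rate A B C D X x u = 2 * (u \<bullet> (C *v x + D *v u)) - 2 * ((X *v x) \<bullet> (A *v x + B *v u))"

lemma dissipation_rate_has_integral:
  fixes X :: "real^'n^'n"
  assumes "transpose X = X" and reg: "regular_solution A B u x" and "0 \<le> h"
  shows "((\<lambda>t. dissipation_rate A B C D X (x t) (u t)) has_integral
    (2 * supplied C D u x h - (x h \<bullet> (X *v x h) - x 0 \<bullet> (X *v x 0)))) {0..h}"
proof -
  have "((\<lambda>t. dissipation_rate A B C D X (x t) (u t)) has_integral
    (2 * supplied C D u x h - 2 * (x h \<bullet> (X *v x h) / 2 - x 0 \<bullet> (X *v x 0) / 2))) {0..h}"
    unfolding dissipation_rate_def
    by (intro has_integral_diff has_integral_mult_right supply_has_integral[OF reg]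
        regular_quadratic_has_integral assms)
  then show ?thesis by simp
qed

text \<open>The storage inequality controls only integrals of w. With the input frozen at \<mu>, w
  is continuous in time, so a negative initial value would persist and make the integral over a
  short interval negative.\<close>

lemma (in bounded_extraction) dissipation_rate_nonneg:
  assumes sym: "transpose X = X" and V: "\<And>a. V a = a \<bullet> (X *v a) / 2"
  shows "0 \<le> dissipation_rate A B C D X \<xi> \<mu>"
proof (rule ccontr)
  assume neg: "\<not> 0 \<le> dissipation_rate A B C D X \<xi> \<mu>"
  obtain x where x: "regular_solution A B (\<lambda>t. \<mu>) x" "x 0 = \<xi>"
    using regular_solution_constant_input[of A B \<mu> \<xi>] by auto
  define w where "w t = dissipation_rate A B C D X (x t) \<mu>" for t
  have "continuous_on UNIV w"
    unfolding w_def[abs_def] dissipation_rate_def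
    by (intro continuous_intros matrix_vector_mul_linear
        linear_continuous_on_compose[OF regular_solutionD(3)[OF x(1)]])
  then have "isCont w 0" by (simp add: continuous_on_eq_continuous_at)
  moreover have w0: "w 0 < 0" using neg x(2) by (simp add: w_def)
  ultimately obtain d where d: "0 < d" "\<And>t. dist t 0 < d \<Longrightarrow> dist (w t) (w 0) < - w 0 / 2"
    unfolding continuous_at_eps_delta by (metis half_gt_zero neg_0_less_iff_less)
  define h where "h = d / 2"
  have h: "0 < h" using d(1) by (simp add: h_def)
  have "(w has_integral (2 * supplied C D (\<lambda>t. \<mu>) x h - (x h \<bullet> (X *v x h) - x 0 \<bullet> (X *v x 0)))) {0..h}"
    unfolding w_def[abs_def] using dissipation_rate_has_integral[OF sym x(1)] h by simp
  moreover have "((\<lambda>t. w 0 / 2) has_integral (w 0 / 2 * h)) {0..h}"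
    using has_integral_const_real[of "w 0 / 2" 0 h] h by (simp add: mult.commute)
  ultimately have "2 * supplied C D (\<lambda>t. \<mu>) x h - (x h \<bullet> (X *v x h) - x 0 \<bullet> (X *v x 0)) \<le> w 0 / 2 * h"
  proof (rule has_integral_le)
    fix t assume "t \<in> {0..h}"
    then have "dist (w t) (w 0) < - w 0 / 2" using h by (intro d(2)) (auto simp: h_def)
    then show "w t \<le> w 0 / 2" unfolding dist_real_def by argo
  qed
  moreover have "w 0 / 2 * h < 0" using w0 h by (intro mult_neg_pos) auto
  ultimately show False
    using available_storage_dissipation[OF x(1), of h] h unfolding V by argo
qed

text \<open>Since N is the inverse of M, N^T N is the inverse of D + D^T, and the claim is the
  algebraic Riccati equation of the available storage. A positive value of the form of Q would cost
  a fixed amount of energy over a short time, however good the extraction.\<close>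

lemma (in bounded_extraction) riccati_equation:
  fixes M N :: "real^'m^'m"
  assumes sym: "transpose X = X" and V: "\<And>a. V a = a \<bullet> (X *v a) / 2"
    and D: "D + transpose D = M ** transpose M" and MN: "M ** N = mat 1"
  shows "lyapunov_op A X = - (transpose (N ** (C - transpose B ** X)) ** (N ** (C - transpose B ** X)))"
proof -
  let ?K = "N ** (C - transpose B ** X)"
  let ?w = "dissipation_rate A B C D X"
  define Q where "Q = - (lyapunov_op A X + transpose ?K ** ?K)"
  define v where "v x u = transpose M *v u + ?K *v x" for x u
  have NM: "transpose M *v (transpose N *v y) = y" "transpose N *v (transpose M *v y) = y" for y
  proof -
    have 1: "transpose N ** transpose M = mat 1"
      using arg_cong[OF MN, of transpose] by (simp add: matrix_transpose_mul)
    then have 2: "transpose M ** transpose N = mat 1"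
      using matrix_left_right_inverse[of "transpose N" "transpose M"] by blast
    show "transpose N *v (transpose M *v y) = y" "transpose M *v (transpose N *v y) = y"
      unfolding matrix_vector_mul_assoc 1 2 by (rule matrix_vector_mul_lid)+
  qed
  have Qform: "x \<bullet> (Q *v y) = - (x \<bullet> (lyapunov_op A X *v y)) - (?K *v x) \<bullet> (?K *v y)" for x y
  proof -
    have "Q *v y = - (lyapunov_op A X *v y) - transpose ?K ** ?K *v y"
      using matrix_vector_mult_diff_rdistrib[of 0 "lyapunov_op A X + transpose ?K ** ?K" y]
      by (simp add: Q_def matrix_vector_mult_add_rdistrib)
    then show ?thesis using inner_gram[of x "transpose ?K" y] by (simp add: inner_diff_right)
  qed
  have w: "?w x u = (norm (v x u))\<^sup>2 + x \<bullet> (Q *v x)" for x u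
  proof -
    have "M ** ?K = C - transpose B ** X" by (simp add: matrix_mul_assoc MN)
    then have "u \<bullet> ((C - transpose B ** X) *v x) = (transpose M *v u) \<bullet> (?K *v x)"
      by (metis inner_transpose_mult inner_commute matrix_vector_mul_assoc)
    then show ?thesis
      unfolding dissipation_rate_def dissipation_form[OF sym] D inner_gram Qform v_def
        power2_norm_eq_inner
      by (simp add: inner_add_left inner_add_right inner_commute del: transpose_matrix_vector)
  qed
  have Qsym: "transpose Q = Q"
    unfolding matrix_eq_bilinear inner_transpose_mult Qform
    by (metis inner_commute inner_transpose_mult lyapunov_op_transpose sym)
  have Qpsd: "0 \<le> x \<bullet> (Q *v x)" for x
  proof -
    \<comment> \<open>This input makes the square vanish, so there w reduces to the form of
      Q.\<close>
    have "v x (- (transpose N *v (?K *v x))) = 0"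
      using NM(1)[of "?K *v x"] unfolding v_def
      by (simp add: linear_neg[OF matrix_vector_mul_linear] del: transpose_matrix_vector)
    then show ?thesis
      using dissipation_rate_nonneg[OF sym V, of x "- (transpose N *v (?K *v x))"] by (simp add: w)
  qed
  \<comment> \<open>F governs the state when v = 0, and G passes the deviation v into the
    dynamics.\<close>
  define F where "F = A - B ** transpose N ** ?K"
  define G where "G = B ** transpose N"
  have closed_loop: "A *v x + B *v u = F *v x + G *v v x u" for x u
  proof -
    have "G *v v x u = B *v u + G *v (?K *v x)"
      unfolding v_def matrix_vector_right_distrib G_def
      by (simp only: matrix_vector_mul_assoc[symmetric] NM(2))
    moreover have "F *v x = A *v x - G *v (?K *v x)"
      by (simp only: F_def G_def matrix_vector_mult_diff_rdistrib matrix_vector_mul_assoc)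
    ultimately show ?thesis by simp
  qed
  have "\<xi> \<bullet> (Q *v \<xi>) = 0" for \<xi>
  proof (rule ccontr)
    define q where "q = \<xi> \<bullet> (Q *v \<xi>)"
    assume "\<xi> \<bullet> (Q *v \<xi>) \<noteq> 0"
    then have q: "0 < q" using Qpsd[of \<xi>] by (simp add: q_def)
    obtain a where a: "0 < a" "\<And>x. norm (F *v x) \<le> norm x * a"
      using bounded_linear.pos_bounded[OF matrix_vector_mul_bounded_linear[of F]] by blast
    obtain g where g: "0 < g" "\<And>x. norm (G *v x) \<le> norm x * g"
      using bounded_linear.pos_bounded[OF matrix_vector_mul_bounded_linear[of G]] by blast
    have "isCont (\<lambda>x. x \<bullet> (Q *v x)) \<xi>"
      by (intro continuous_intros linear_continuous_at) simp
    then obtain d where d: "0 < d"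
        "\<And>x. dist x \<xi> < d \<Longrightarrow> dist (x \<bullet> (Q *v x)) (\<xi> \<bullet> (Q *v \<xi>)) < q / 2"
      using half_gt_zero[OF q] unfolding continuous_at_eps_delta by blast
    have near: "q / 2 \<le> x \<bullet> (Q *v x)" if "norm (x - \<xi>) < d" for x
      using d(2)[of x] that unfolding dist_norm q_def[symmetric] real_norm_def by argo
    \<comment> \<open>These bounds serve the estimate of the maximal deviation m: h a <= 1/2 absorbs
      half of m, while h a |\<xi>|, h g / 2 and, through e, g e are each at most d / 8, so m <= 3 d
      / 4 < d. The summand 1 avoids division by a zero norm.\<close>
    define h where "h = min (1 / (2 * a)) (min (d / (8 * a * (norm \<xi> + 1))) (d / (4 * g)))"
    have n1: "0 < norm \<xi> + 1" using norm_ge_zero[of \<xi>] by linarith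
    have h: "0 < h" using a g d(1) n1 by (simp add: h_def)
    have h1: "h * a \<le> 1 / 2"
    proof -
      have "h \<le> 1 / (2 * a)" by (simp add: h_def)
      then show ?thesis using a by (simp add: field_simps)
    qed
    have h2: "h * (a * norm \<xi>) \<le> d / 8"
    proof -
      have "h \<le> d / (8 * a * (norm \<xi> + 1))" by (simp add: h_def)
      then have "h * (8 * a * (norm \<xi> + 1)) \<le> d" using a n1 by (simp add: pos_le_divide_eq)
      moreover have "0 \<le> h * a" using h a by simp
      ultimately show ?thesis by (simp add: algebra_simps)
    qed
    have h3: "h * (g / 2) \<le> d / 8"
    proof -
      have "h \<le> d / (4 * g)" by (simp add: h_def)
      then show ?thesis using g by (simp add: field_simps)
    qed
    \<comment> \<open>Besides g e <= d / 8, this makes the total loss 2 e at most q h / 4, below the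
      q h / 2 that w >= q / 2 on [0, h] would cost.\<close>
    define e where "e = min (d / (8 * g)) (q * h / 8)"
    have e: "0 < e" using g d(1) q h by (simp add: e_def)
    have e1: "g * e \<le> d / 8"
    proof -
      have "e \<le> d / (8 * g)" by (simp add: e_def)
      then show ?thesis using g by (simp add: field_simps)
    qed
    have e2: "e \<le> q * h / 8" by (simp add: e_def)
    obtain u0 x0 T0 where 0: "regular_solution A B u0 x0" "x0 0 = \<xi>" "0 \<le> T0" "V \<xi> - e < - supplied C D u0 x0 T0"
      by (rule available_storage_approx[OF e, of \<xi>])
    \<comment> \<open>The nearly optimal extraction may stop before h; idling extends it over all of
      [0, h].\<close>
    define T where "T = max T0 h"
    obtain u x where reg: "regular_solution A B u x" and x0: "x 0 = \<xi>"
      and "supplied C D u x T = supplied C D u0 x0 T0"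
      using regular_solution_extend[OF 0(1,3), of T C D] 0(2) by (auto simp: T_def)
    then have sup: "V \<xi> - e < - supplied C D u x T" using 0(4) by simp
    have T: "h \<le> T" "0 \<le> T" using h by (auto simp: T_def)
    note wint = dissipation_rate_has_integral[OF sym reg, where C = C and D = D]
    have wint': "(\<lambda>t. ?w (x t) (u t)) integrable_on {0..t}" if "0 \<le> t" for t
      using wint[OF that] by blast
    have w0: "0 \<le> ?w (x t) (u t)" for t by (rule dissipation_rate_nonneg[OF sym V])
    \<comment> \<open>The loss is twice the gap to optimality minus 2 V (x T), and the latter is
      dropped by nonnegativity.\<close>
    have wT: "integral {0..T} (\<lambda>t. ?w (x t) (u t)) \<le> 2 * e"
    proof -
      have "integral {0..T} (\<lambda>t. ?w (x t) (u t))
          = 2 * supplied C D u x T - (x T \<bullet> (X *v x T) - x 0 \<bullet> (X *v x 0))"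
        by (rule integral_unique[OF wint[OF T(2)]])
      also have "\<dots> = 2 * supplied C D u x T - 2 * V (x T) + 2 * V \<xi>" by (simp add: V x0)
      finally show ?thesis using sup available_storage_nonneg[of "x T"] by argo
    qed
    have wt: "integral {0..t} (\<lambda>t. ?w (x t) (u t)) \<le> 2 * e" if "t \<in> {0..h}" for t
    proof -
      have "integral {0..t} (\<lambda>t. ?w (x t) (u t)) \<le> integral {0..T} (\<lambda>t. ?w (x t) (u t))"
        using that T w0 by (intro integral_subset_le wint') auto
      then show ?thesis using wT by linarith
    qed
    \<comment> \<open>Evaluating the bound where the deviation is largest puts m on both sides;
      absorbing m / 2 replaces a Gronwall estimate.\<close>
    obtain \<tau> where \<tau>: "\<tau> \<in> {0..h}" "\<And>t. t \<in> {0..h} \<Longrightarrow> norm (x t - \<xi>) \<le> norm (x \<tau> - \<xi>)"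
    proof -
      have "\<exists>s\<in>{0..h}. \<forall>t\<in>{0..h}. norm (x t - \<xi>) \<le> norm (x s - \<xi>)"
        using h by (intro continuous_attains_sup continuous_intros regular_solutionD(3)[OF reg]) auto
      then show ?thesis using that by blast
    qed
    define m where "m = norm (x \<tau> - \<xi>)"
    have m0: "0 \<le> m" by (simp add: m_def)
    define c where "c = a * norm \<xi> + a * m + g / 2"
    have "norm (x \<tau> - x 0) \<le> c * \<tau> + g / 2 * integral {0..\<tau>} (\<lambda>t. ?w (x t) (u t))"
    proof -
      have \<tau>0: "0 \<le> \<tau>" using \<tau>(1) by simp
      have f: "((\<lambda>t. A *v x t + B *v u t) has_integral (x \<tau> - x 0)) {0..\<tau>}"
        by (rule regular_solution_has_integral[OF reg \<tau>0])
      have k: "((\<lambda>t. c + g / 2 * ?w (x t) (u t)) has_integral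
          (c * \<tau> + g / 2 * integral {0..\<tau>} (\<lambda>t. ?w (x t) (u t)))) {0..\<tau>}"
        using has_integral_const_real[of c 0 \<tau>] \<tau>0
        by (intro has_integral_add has_integral_mult_right integrable_integral[OF wint'[OF \<tau>0]])
          (simp add: mult.commute)
      have "norm (A *v x t + B *v u t) \<le> c + g / 2 * ?w (x t) (u t)" if "t \<in> {0..\<tau>}" for t
      proof -
        have "norm (x t) \<le> norm \<xi> + m"
          using \<tau>(2)[of t] \<tau>(1) that norm_triangle_ineq[of \<xi> "x t - \<xi>"] by (auto simp: m_def)
        then have "norm (x t) * a \<le> (norm \<xi> + m) * a" using a by (intro mult_right_mono) auto
        then have 1: "norm (F *v x t) \<le> a * norm \<xi> + a * m"
          using a(2)[of "x t"] by (simp add: algebra_simps)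
        let ?n = "norm (v (x t) (u t))"
        \<comment> \<open>The velocity is linear in |v| while w controls |v|^2; this bound lets the
          displacement be estimated by the integral of w.\<close>
        have "?n \<le> (1 + ?n\<^sup>2) / 2" using sum_squares_bound[of ?n 1] by simp
        also have "\<dots> \<le> (1 + ?w (x t) (u t)) / 2" using w[of "x t" "u t"] Qpsd[of "x t"] by simp
        finally have "?n * g \<le> (1 + ?w (x t) (u t)) / 2 * g" using g by (intro mult_right_mono) auto
        then have 2: "norm (G *v v (x t) (u t)) \<le> g / 2 + g / 2 * ?w (x t) (u t)"
          using g(2)[of "v (x t) (u t)"] by (simp add: algebra_simps)
        show ?thesis
          unfolding closed_loop c_def
          using norm_triangle_ineq[of "F *v x t" "G *v v (x t) (u t)"] 1 2 by linarith
      qed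
      from integral_norm_bound_integral[OF has_integral_integrable[OF f] has_integral_integrable[OF k] this]
      show ?thesis unfolding integral_unique[OF f] integral_unique[OF k] .
    qed
    also have "\<dots> \<le> c * h + g / 2 * (2 * e)"
    proof (intro add_mono mult_left_mono wt \<tau>(1))
      show "0 \<le> c" using a g m0 by (simp add: c_def)
    qed (use \<tau> g in auto)
    finally have "m \<le> h * (a * norm \<xi>) + h * a * m + h * (g / 2) + g * e"
      by (simp add: m_def x0 c_def algebra_simps)
    moreover have "h * a * m \<le> 1 / 2 * m" using h1 m0 by (rule mult_right_mono)
    ultimately have "m < d" using h2 h3 e1 d(1) by linarith
    then have "q / 2 \<le> ?w (x t) (u t)" if "t \<in> {0..h}" for t
      using near[of "x t"] \<tau>(2)[OF that] w[of "x t" "u t"] zero_le_power2[of "norm (v (x t) (u t))"]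
      unfolding m_def by linarith
    then have "q / 2 * h \<le> integral {0..h} (\<lambda>t. ?w (x t) (u t))"
      using has_integral_le[OF has_integral_const_real[of "q / 2" 0 h] integrable_integral[OF wint'[of h]]] h
      by (simp add: mult.commute)
    moreover have "integral {0..h} (\<lambda>t. ?w (x t) (u t)) \<le> 2 * e" using h by (intro wt) simp
    moreover have "0 < q * h" using q h by simp
    ultimately show False using e2 by argo
  qed
  then have "x \<bullet> (Q *v y) = 0" for x y
    using psd_form_Cauchy_Schwarz[OF Qsym Qpsd, of x y] by simp
  then have "Q = 0" by (simp add: matrix_eq_bilinear)
  then have "lyapunov_op A X + transpose ?K ** ?K = 0"
    unfolding Q_def by (simp only: neg_equal_0_iff_equal)
  then show ?thesis by (simp only: eq_neg_iff_add_eq_0)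
qed

section \<open>The singular case\<close>

lemma (in bounded_extraction) available_storage_quadratic:
  obtains X :: "real^'n^'n" where "transpose X = X" "\<And>a. V a = a \<bullet> (X *v a) / 2"
  using available_storage_nonneg available_storage_parallelogram available_storage_scaleR
  by (rule parallelogram_imp_quadratic) (rule that)

text \<open>At x = 0 the dissipation rate is exactly this form.\<close>

lemma (in bounded_extraction) feedthrough_nonneg: "0 \<le> \<mu> \<bullet> ((D + transpose D) *v \<mu>)"
proof -
  obtain X :: "real^'n^'n" where X: "transpose X = X" "\<And>a. V a = a \<bullet> (X *v a) / 2"
    by (rule available_storage_quadratic, rule that)
  show ?thesis
    using dissipation_rate_nonneg[OF X, of 0 \<mu>] unfolding dissipation_rate_def dissipation_form[OF X(1)]
    by simp
qed

text \<open>Positive definiteness makes the factor M invertible. The bounds on X by H are recorded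
  because they do not depend on D and will supply compactness.\<close>

lemma (in bounded_extraction) coercive_kyp:
  assumes pos: "\<And>\<mu>. \<mu> \<noteq> 0 \<Longrightarrow> 0 < \<mu> \<bullet> ((D + transpose D) *v \<mu>)"
  obtains X :: "real^'n^'n" and L :: "real^'m^'n" and M :: "real^'m^'m"
  where "transpose X = X" "\<And>a. 0 \<le> a \<bullet> (X *v a)" "\<And>a. a \<bullet> (X *v a) \<le> 2 * H a"
    "lyapunov_op A X = - (L ** transpose L)" "C = transpose B ** X + M ** transpose L"
    "D + transpose D = M ** transpose M"
proof -
  obtain X :: "real^'n^'n" where X: "transpose X = X" "\<And>a. V a = a \<bullet> (X *v a) / 2"
    by (rule available_storage_quadratic, rule that)
  have "transpose (D + transpose D) = D + transpose D"
    by (simp add: transpose_def vec_eq_iff)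
  then obtain M :: "real^'m^'m" where M: "D + transpose D = M ** transpose M"
    using feedthrough_nonneg by (rule psd_factorization)
  have "transpose M *v y \<noteq> 0" if "y \<noteq> 0" for y
    using pos[OF that] unfolding M inner_gram by auto
  then have "inj ((*v) (transpose M))"
    unfolding linear_injective_0[OF matrix_vector_mul_linear] by blast
  then obtain N where NM: "N ** transpose M = mat 1"
    unfolding matrix_left_invertible_injective[symmetric] by blast
  have "M ** transpose N = mat 1"
    using arg_cong[OF NM, of transpose] by (simp add: matrix_transpose_mul)
  note ric = riccati_equation[OF X M this] and MN = this
  \<comment> \<open>L^T is M^(-1) (C - B^T X): then M L^T returns C - B^T X, and L L^T is the
    Riccati term.\<close>
  define L where "L = transpose (transpose N ** (C - transpose B ** X))"
  show ?thesis
  proof (rule that[OF X(1), of L M])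
    show "0 \<le> a \<bullet> (X *v a)" "a \<bullet> (X *v a) \<le> 2 * H a" for a
      using available_storage_nonneg[of a] available_storage_le[of a] X(2)[of a] by linarith+
    show "lyapunov_op A X = - (L ** transpose L)"
      unfolding ric L_def transpose_transpose by (rule refl)
    show "C = transpose B ** X + M ** transpose L"
      by (simp add: L_def matrix_mul_assoc MN)
  qed (rule M)
qed

lemma passive_imp_bounded_extraction:
  assumes "storage_function A B C D H"
  shows "bounded_extraction A B C D H"
proof
  fix u x and T :: real
  assume reg: "regular_solution A B u x" and T: "0 \<le> T"
  have u: "locally_square_integrable u"
    using regular_solution_trajectory[OF reg] by (simp add: trajectory_def)
  have "(LINT t:{0..T}|lebesgue. u t \<bullet> (C *v x t + D *v u t)) = supplied C D u x T"
    unfolding supplied_def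
    by (rule set_lebesgue_integral_eq_integral(2)[OF supply_rate_set_integrable[OF u regular_solutionD(3)[OF reg]]])
  moreover have "0 \<le> H (x T)"
    and "H (x T) \<le> H (x 0) + (LINT t:{0..T}|lebesgue. u t \<bullet> (C *v x t + D *v u t))"
    using assms regular_solution_trajectory[OF reg, of C D] T unfolding storage_function_def by blast+
  ultimately show "- supplied C D u x T \<le> H (x 0)" by linarith
qed

text \<open>The regularization adds e |u|^2 to the supply rate, so no more energy can be extracted
  than before.\<close>

lemma (in bounded_extraction) bounded_extraction_regularized:
  assumes "0 \<le> e"
  shows "bounded_extraction A B C (D + e *\<^sub>R mat 1) H"
proof
  fix u x and T :: real
  assume reg: "regular_solution A B u x" and T: "0 \<le> T"
  have "supplied C D u x T \<le> supplied C (D + e *\<^sub>R mat 1) u x T"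
  proof (rule has_integral_le[OF supply_has_integral[OF reg] supply_has_integral[OF reg]])
    fix t
    have "(D + e *\<^sub>R mat 1) *v u t = D *v u t + e *\<^sub>R u t"
      by (simp add: matrix_vector_mult_add_rdistrib scaleR_matrix_vector_assoc[symmetric])
    then show "u t \<bullet> (C *v x t + D *v u t) \<le> u t \<bullet> (C *v x t + (D + e *\<^sub>R mat 1) *v u t)"
      using assms by (simp add: inner_add_right)
  qed
  then show "- supplied C (D + e *\<^sub>R mat 1) u x T \<le> H (x 0)"
    using extraction_le[OF reg T] by linarith
qed

section \<open>Uniform bounds and the limit of the regularized equations\<close>

lemma tendsto_matrix_mult:
  fixes P :: "'b \<Rightarrow> real^'k^'m" and Q :: "'b \<Rightarrow> real^'n^'k"
  assumes "(P \<longlongrightarrow> P') F" "(Q \<longlongrightarrow> Q') F"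
  shows "((\<lambda>i. P i ** Q i) \<longlongrightarrow> P' ** Q') F"
  unfolding matrix_matrix_mult_def by (intro tendsto_intros assms)

lemma tendsto_transpose:
  fixes P :: "'b \<Rightarrow> real^'k^'m"
  assumes "(P \<longlongrightarrow> P') F"
  shows "((\<lambda>i. transpose (P i)) \<longlongrightarrow> transpose P') F"
  unfolding transpose_def by (intro tendsto_intros assms)

text \<open>The diagonal of L L^T holds the squared row norms of L, and s <= 1 + s^2. Thus bounds on
  the Gram matrices bound the factors.\<close>

lemma norm_matrix_le_gram:
  fixes L :: "real^'m^'n"
  shows "norm L \<le> CARD('n) * (1 + norm (L ** transpose L))"
proof -
  have "norm (L $ i) \<le> 1 + norm (L ** transpose L)" for i
  proof -
    have "(norm (L $ i))\<^sup>2 = (L ** transpose L) $ i $ i"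
      by (simp add: matrix_matrix_mult_def transpose_def power2_norm_eq_inner inner_vec_def)
    also have "\<dots> \<le> norm (L ** transpose L)"
      using Finite_Cartesian_Product.norm_nth_le[of "(L ** transpose L) $ i" i]
        Finite_Cartesian_Product.norm_nth_le[of "L ** transpose L" i] by simp
    finally have "(norm (L $ i))\<^sup>2 \<le> norm (L ** transpose L)" .
    moreover have "2 * norm (L $ i) \<le> (norm (L $ i))\<^sup>2 + 1"
      using sum_squares_bound[of "norm (L $ i)" 1] by simp
    ultimately show ?thesis using norm_ge_zero[of "L $ i"] by linarith
  qed
  then have "(\<Sum>i\<in>UNIV. norm (L $ i)) \<le> (\<Sum>i\<in>(UNIV :: 'n set). 1 + norm (L ** transpose L))"
    by (intro sum_mono)
  moreover have "norm L \<le> (\<Sum>i\<in>UNIV. norm (L $ i))"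
    unfolding norm_vec_def by (rule L2_set_le_sum) simp
  ultimately show ?thesis by simp
qed

text \<open>Entries are polarized values of the form, controlled by nonnegativity at a + b and a -
  b. Only the values of H at unit vectors enter, so the bound is uniform over the regularized
  systems.\<close>

lemma norm_matrix_le_form:
  fixes X :: "real^'n^'n"
  assumes sym: "transpose X = X" and psd: "\<And>a. 0 \<le> a \<bullet> (X *v a)" and le: "\<And>a. a \<bullet> (X *v a) \<le> 2 * H a"
  shows "norm X \<le> (\<Sum>i\<in>UNIV. \<Sum>k\<in>UNIV. H (axis i 1) + H (axis k 1))"
proof -
  have X: "a \<bullet> (X *v b) = b \<bullet> (X *v a)" for a b
    by (metis inner_transpose_mult sym)
  have bound: "\<bar>a \<bullet> (X *v b)\<bar> \<le> H a + H b" for a b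
  proof -
    have "(a + b) \<bullet> (X *v (a + b)) = a \<bullet> (X *v a) + b \<bullet> (X *v b) + 2 * (a \<bullet> (X *v b))"
      "(a - b) \<bullet> (X *v (a - b)) = a \<bullet> (X *v a) + b \<bullet> (X *v b) - 2 * (a \<bullet> (X *v b))"
      using X[of b a]
      by (simp_all add: matrix_vector_right_distrib matrix_vector_mult_diff_distrib inner_add_left
          inner_add_right inner_diff_left inner_diff_right)
    then show ?thesis using psd[of "a + b"] psd[of "a - b"] le[of a] le[of b] by linarith
  qed
  have entry: "X $ i $ k = axis i 1 \<bullet> (X *v axis k 1)" for i k
    by (simp add: inner_axis' matrix_vector_mult_basis column_def)
  have "norm X \<le> (\<Sum>i\<in>UNIV. norm (X $ i))"
    unfolding norm_vec_def[of X] by (rule L2_set_le_sum) simp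
  also have "\<dots> \<le> (\<Sum>i\<in>UNIV. \<Sum>k\<in>UNIV. \<bar>X $ i $ k\<bar>)"
    by (intro sum_mono) (rule norm_le_l1_cart)
  also have "\<dots> \<le> (\<Sum>i\<in>UNIV. \<Sum>k\<in>UNIV. H (axis i 1) + H (axis k 1))"
    unfolding entry by (intro sum_mono bound)
  finally show ?thesis .
qed

lemma passive_imp_kyp:
  fixes A :: "real^'n^'n" and B :: "real^'m^'n" and C :: "real^'n^'m" and D :: "real^'m^'m"
  assumes "is_passive A B C D"
  obtains X :: "real^'n^'n" and L :: "real^'m^'n" and M :: "real^'m^'m"
  where "lyapunov_op A X = - (L ** transpose L)" "C = transpose B ** X + M ** transpose L"
    "D + transpose D = M ** transpose M"
proof -
  obtain H where "storage_function A B C D H" using assms unfolding is_passive_def by blast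
  then interpret bounded_extraction A B C D H by (rule passive_imp_bounded_extraction)
  define e where "e j = inverse (real (Suc j))" for j
  define D' where "D' j = D + e j *\<^sub>R mat 1" for j
  have e: "0 < e j" for j by (simp add: e_def)
  have "\<exists>X L M. transpose X = X \<and> (\<forall>a. 0 \<le> a \<bullet> (X *v a)) \<and> (\<forall>a. a \<bullet> (X *v a) \<le> 2 * H a) \<and>
      lyapunov_op A X = - (L ** transpose (L :: real^'m^'n)) \<and>
      C = transpose B ** X + M ** transpose L \<and> D' j + transpose (D' j) = M ** transpose M" for j
  proof -
    interpret reg: bounded_extraction A B C "D' j" H
      unfolding D'_def using e[of j] by (intro bounded_extraction_regularized) simp
    have "D' j + transpose (D' j) = D + transpose D + (2 * e j) *\<^sub>R mat 1"
      by (auto simp: D'_def transpose_def vec_eq_iff mat_def)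
    then have "\<mu> \<bullet> ((D' j + transpose (D' j)) *v \<mu>) = \<mu> \<bullet> ((D + transpose D) *v \<mu>) + 2 * e j * (\<mu> \<bullet> \<mu>)" for \<mu>
      by (simp add: matrix_vector_mult_add_rdistrib scaleR_matrix_vector_assoc[symmetric] inner_add_right)
    then have pos: "0 < \<mu> \<bullet> ((D' j + transpose (D' j)) *v \<mu>)" if "\<mu> \<noteq> 0" for \<mu>
      using feedthrough_nonneg[of \<mu>] e[of j] that by (simp add: add_nonneg_pos)
    obtain X :: "real^'n^'n" and L :: "real^'m^'n" and M :: "real^'m^'m"
      where "transpose X = X" "\<And>a. 0 \<le> a \<bullet> (X *v a)" "\<And>a. a \<bullet> (X *v a) \<le> 2 * H a"
        "lyapunov_op A X = - (L ** transpose L)" "C = transpose B ** X + M ** transpose L"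
        "D' j + transpose (D' j) = M ** transpose M"
      by (rule reg.coercive_kyp[OF pos], assumption, rule that)
    then show ?thesis by (intro exI[of _ X] exI[of _ L] exI[of _ M]) simp
  qed
  then obtain X :: "nat \<Rightarrow> real^'n^'n" and L :: "nat \<Rightarrow> real^'m^'n" and M :: "nat \<Rightarrow> real^'m^'m"
    where kyp: "\<And>j. transpose (X j) = X j" "\<And>j a. 0 \<le> a \<bullet> (X j *v a)" "\<And>j a. a \<bullet> (X j *v a) \<le> 2 * H a"
      "\<And>j. lyapunov_op A (X j) = - (L j ** transpose (L j))"
      "\<And>j. C = transpose B ** X j + M j ** transpose (L j)"
      "\<And>j. D' j + transpose (D' j) = M j ** transpose (M j)"
    by metis
  define K where "K = (\<Sum>i\<in>UNIV. \<Sum>k\<in>UNIV. H (axis i 1) + H (axis k (1 :: real) :: real^'n))"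
  have X: "norm (X j) \<le> K" for j unfolding K_def by (rule norm_matrix_le_form[OF kyp(1,2,3)])
  have "bounded_linear (lyapunov_op A)" using linear_lyapunov_op by (simp add: linear_conv_bounded_linear)
  then obtain c where c: "0 < c" "\<And>Y. norm (lyapunov_op A Y) \<le> norm Y * c"
    using bounded_linear.pos_bounded by blast
  have LL: "norm (L j ** transpose (L j)) \<le> K * c" for j
  proof -
    have "norm (L j ** transpose (L j)) = norm (lyapunov_op A (X j))" by (simp add: kyp(4))
    then show ?thesis using c(2)[of "X j"] mult_right_mono[OF X[of j], of c] c(1) by linarith
  qed
  have L: "norm (L j) \<le> CARD('n) * (1 + K * c)" for j
    by (rule order_trans[OF norm_matrix_le_gram mult_left_mono[OF add_left_mono[OF LL]]]) simp
  have MM: "norm (D' j + transpose (D' j)) \<le> norm (D + transpose D) + 2 * norm (mat 1 :: real^'m^'m)" for j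
  proof -
    have "D' j + transpose (D' j) = D + transpose D + (2 * e j) *\<^sub>R mat 1"
      by (auto simp: D'_def transpose_def vec_eq_iff mat_def)
    moreover have "e j \<le> 1" by (simp add: e_def inverse_le_1_iff)
    ultimately show ?thesis
      using norm_triangle_ineq[of "D + transpose D" "(2 * e j) *\<^sub>R mat 1"] e[of j]
        mult_right_mono[of "2 * e j" 2 "norm (mat 1 :: real^'m^'m)"] by simp
  qed
  have M: "norm (M j) \<le> CARD('m) * (1 + (norm (D + transpose D) + 2 * norm (mat 1 :: real^'m^'m)))" for j
    by (rule order_trans[OF norm_matrix_le_gram mult_left_mono[OF add_left_mono[OF MM[unfolded kyp(6)]]]])
      simp
  \<comment> \<open>Treating the triple as one bounded sequence yields a single subsequence along
    which X, L and M all converge.\<close>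
  have "bounded (range (\<lambda>j. (X j, L j, M j)))"
  proof (rule bounded_subset)
    show "bounded (range X \<times> range L \<times> range M)"
      using X L M by (intro bounded_Times) (auto simp: bounded_iff)
  qed auto
  then obtain l r where r: "strict_mono r" and lim: "((\<lambda>j. (X j, L j, M j)) \<circ> r) \<longlonglongrightarrow> l"
    using bounded_imp_convergent_subsequence by blast
  define X' L' M' where "X' = fst l" and "L' = fst (snd l)" and "M' = snd (snd l)"
  have Xl: "(\<lambda>j. X (r j)) \<longlonglongrightarrow> X'" and Ll: "(\<lambda>j. L (r j)) \<longlonglongrightarrow> L'" and Ml: "(\<lambda>j. M (r j)) \<longlonglongrightarrow> M'"
    using tendsto_fst[OF lim] tendsto_fst[OF tendsto_snd[OF lim]] tendsto_snd[OF tendsto_snd[OF lim]]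
    by (simp_all add: X'_def L'_def M'_def o_def)
  have "lyapunov_op A X' = - (L' ** transpose L')"
  proof (rule LIMSEQ_unique)
    show "(\<lambda>j. lyapunov_op A (X (r j))) \<longlonglongrightarrow> lyapunov_op A X'"
      unfolding lyapunov_op_def by (intro tendsto_intros tendsto_matrix_mult Xl)
    show "(\<lambda>j. lyapunov_op A (X (r j))) \<longlonglongrightarrow> - (L' ** transpose L')"
      unfolding kyp(4) by (intro tendsto_intros tendsto_matrix_mult tendsto_transpose Ll)
  qed
  moreover have "C = transpose B ** X' + M' ** transpose L'"
  proof (rule LIMSEQ_unique)
    show "(\<lambda>j. transpose B ** X (r j) + M (r j) ** transpose (L (r j))) \<longlonglongrightarrow> C"
      unfolding kyp(5)[symmetric] by (rule tendsto_const)
    show "(\<lambda>j. transpose B ** X (r j) + M (r j) ** transpose (L (r j)))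
        \<longlonglongrightarrow> transpose B ** X' + M' ** transpose L'"
      by (intro tendsto_intros tendsto_matrix_mult tendsto_transpose Xl Ll Ml)
  qed
  moreover have "D + transpose D = M' ** transpose M'"
  proof (rule LIMSEQ_unique)
    have "(\<lambda>j. e (r j)) \<longlonglongrightarrow> 0"
      using LIMSEQ_subseq_LIMSEQ[OF LIMSEQ_inverse_real_of_nat r] by (simp add: e_def o_def)
    then have "(\<lambda>j. D' (r j)) \<longlonglongrightarrow> D + 0 *\<^sub>R mat 1"
      unfolding D'_def by (intro tendsto_intros)
    then have "(\<lambda>j. D' (r j)) \<longlonglongrightarrow> D" by simp
    then show "(\<lambda>j. D' (r j) + transpose (D' (r j))) \<longlonglongrightarrow> D + transpose D"
      by (intro tendsto_intros tendsto_transpose)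
    show "(\<lambda>j. D' (r j) + transpose (D' (r j))) \<longlonglongrightarrow> M' ** transpose M'"
      unfolding kyp(6) by (intro tendsto_matrix_mult tendsto_transpose Ml)
  qed
  ultimately show ?thesis by (rule that)
qed

theorem proposition2p4:
  fixes A :: "real^'n^'n" and B :: "real^'m^'n" and C :: "real^'n^'m" and D :: "real^'m^'m"
  assumes "hurwitz A"
  shows "bij (lyapunov_op A) \<and>
    (is_passive A B C D \<longleftrightarrow>
      (\<exists>(L :: real^'m^'n) (M :: real^'m^'m).
        C = transpose B ** inv (lyapunov_op A) (- (L ** transpose L)) + M ** transpose L \<and>
        D + transpose D = M ** transpose M))"
proof (intro conjI iffI)
  show bij: "bij (lyapunov_op A)" by (rule bij_lyapunov_op[OF assms])
  show "is_passive A B C D"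
    if ex: "\<exists>(L :: real^'m^'n) (M :: real^'m^'m).
        C = transpose B ** inv (lyapunov_op A) (- (L ** transpose L)) + M ** transpose L \<and>
        D + transpose D = M ** transpose M"
  proof -
    obtain L :: "real^'m^'n" and M :: "real^'m^'m" where
      "C = transpose B ** inv (lyapunov_op A) (- (L ** transpose L)) + M ** transpose L"
      "D + transpose D = M ** transpose M"
      using ex by blast
    then show ?thesis
      by (rule kyp_imp_passive[OF assms surj_f_inv_f[OF bij_is_surj[OF bij]]])
  qed
  assume "is_passive A B C D"
  then obtain X :: "real^'n^'n" and L :: "real^'m^'n" and M :: "real^'m^'m"
    where X: "lyapunov_op A X = - (L ** transpose L)"
      and "C = transpose B ** X + M ** transpose L" "D + transpose D = M ** transpose M"
    by (rule passive_imp_kyp)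
  moreover have "inv (lyapunov_op A) (- (L ** transpose L)) = X"
    unfolding X[symmetric] by (rule inv_f_f[OF bij_is_inj[OF bij]])
  ultimately show "\<exists>(L :: real^'m^'n) (M :: real^'m^'m).
        C = transpose B ** inv (lyapunov_op A) (- (L ** transpose L)) + M ** transpose L \<and>
        D + transpose D = M ** transpose M"
    by (intro exI[of _ L] exI[of _ M]) simp
qed

end
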